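(* A Hankel operator $H$ of finite rank in the space $L^2(\mathbb{R}_+)$ is positive (respectively, negative) if and only if its kernel is given by the formula $$h(t)=\sum_{m=1}^{M_0}\mathsf{p}_m e^{-\alpha_m t},$$ where $\alpha_m>0$ and $\mathsf{p}_m>0$ (respectively, $\mathsf{p}_m<0$) for all $m=1,\dots,M_0$.
   Context: A Hankel operator in $L^2(\mathbb{R}_+)$, $\mathbb{R}_+=(0,\infty)$, with kernel $h$ is the (bounded) operator $(Hf)(t)=\int_0^\infty h(t+s)f(s)\,ds$. Positive (negative) means $H\ge 0$ ($H\le 0$) in the sense of quadratic forms. $M_0\ge 0$ is an integer; the empty sum ($M_0=0$) is zero. *)

theory Defs
  imports "HOL-Analysis.Analysis"
begin

definition half_line :: "real measure" where
  "half_line = lebesgue_on {0<..}"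

text \<open>Elements of \<open>L\<^sup>2(\<real>\<^sub>+)\<close> are represented by functions rather than by classes modulo
  null sets, so equalities of elements are stated almost everywhere. The scalars are complex.\<close>

definition L2 :: "(real \<Rightarrow> complex) set" where
  "L2 = {f. f \<in> borel_measurable half_line \<and> integrable half_line (\<lambda>t. (cmod (f t))\<^sup>2)}"

definition L2_inner :: "(real \<Rightarrow> complex) \<Rightarrow> (real \<Rightarrow> complex) \<Rightarrow> complex" where
  "L2_inner f g = (LINT t|half_line. f t * cnj (g t))"

definition L2_norm :: "(real \<Rightarrow> complex) \<Rightarrow> real" where
  "L2_norm f = sqrt (LINT t|half_line. (cmod (f t))\<^sup>2)"

definition L2_bounded :: "((real \<Rightarrow> complex) \<Rightarrow> real \<Rightarrow> complex) \<Rightarrow> bool" where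
  "L2_bounded T \<longleftrightarrow>
    (\<forall>f\<in>L2. T f \<in> L2) \<and> (\<exists>C. \<forall>f\<in>L2. L2_norm (T f) \<le> C * L2_norm f)"

text \<open>The range lies, modulo null sets, in the span of finitely many elements.\<close>

definition L2_finite_rank :: "((real \<Rightarrow> complex) \<Rightarrow> real \<Rightarrow> complex) \<Rightarrow> bool" where
  "L2_finite_rank T \<longleftrightarrow>
    (\<exists>(n::nat) g. (\<forall>i<n. g i \<in> L2) \<and>
      (\<forall>f\<in>L2. \<exists>c :: nat \<Rightarrow> complex. AE t in half_line. T f t = (\<Sum>i<n. c i * g i t)))"

text \<open>Sign in the sense of quadratic forms; membership in \<open>\<real>\<^sub>\<ge>\<^sub>0\<close> or \<open>\<real>\<^sub>\<le>\<^sub>0\<close> includes that the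
  form is real-valued.\<close>

definition L2_positive :: "((real \<Rightarrow> complex) \<Rightarrow> real \<Rightarrow> complex) \<Rightarrow> bool" where
  "L2_positive T \<longleftrightarrow> (\<forall>f\<in>L2. L2_inner (T f) f \<in> \<real>\<^sub>\<ge>\<^sub>0)"

definition L2_negative :: "((real \<Rightarrow> complex) \<Rightarrow> real \<Rightarrow> complex) \<Rightarrow> bool" where
  "L2_negative T \<longleftrightarrow> (\<forall>f\<in>L2. L2_inner (T f) f \<in> \<real>\<^sub>\<le>\<^sub>0)"

definition hankel_op :: "(real \<Rightarrow> complex) \<Rightarrow> (real \<Rightarrow> complex) \<Rightarrow> real \<Rightarrow> complex" where
  "hankel_op h f t = (LINT s|half_line. h (t + s) * f s)"

text \<open>Integrals of non-integrable functions are \<open>0\<close> by convention, so convergence of the integral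
  defining the operator has to be required separately.\<close>

definition hankel_kernel :: "(real \<Rightarrow> complex) \<Rightarrow> bool" where
  "hankel_kernel h \<longleftrightarrow>
    h \<in> borel_measurable half_line \<and>
    (\<forall>f\<in>L2. AE t in half_line. integrable half_line (\<lambda>s. h (t + s) * f s)) \<and>
    L2_bounded (hankel_op h)"

end

theory Submission
  imports Defs "HOL-Computational_Algebra.Fundamental_Theorem_Algebra"
begin

text \<open>Write \<open>v\<^sub>a\<close> for the right shift of \<open>e\<^sup>-\<^sup>s\<close> by \<open>a\<close>, and put \<open>F = H v\<^sub>0\<close> and
  \<open>\<beta>(x) = \<integral> F(x + t) e\<^sup>-\<^sup>t dt\<close>. The Hankel structure gives \<open>H v\<^sub>a = F(\<sqdot> + a)\<close> and
  \<open>\<langle>H v\<^sub>a, v\<^sub>b\<rangle> = \<beta>(a + b)\<close>. So positivity of \<open>H\<close> says that the kernel \<open>\<beta>(a + b)\<close> is positive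
  semidefinite, and finite rank forces a linear relation \<open>\<Sum> a\<^sub>k \<beta>(x + k) = 0\<close>.

  Let real polynomials act on \<open>\<beta>\<close> through the unit shift. By Cauchy-Schwarz the annihilator of \<open>\<beta>\<close>
  contains, with any \<open>p \<noteq> 0\<close>, a polynomial from which the multiplicities, the non-real roots and
  the roots \<open>\<le> 0\<close> of \<open>p\<close> have been removed. Lagrange interpolation at the remaining roots splits \<open>\<beta>\<close>
  into nonnegative log-convex parts with \<open>\<gamma>(x + 1) = l \<gamma>(x)\<close>; such a part divided by \<open>l\<^sup>x\<close> is periodic
  and log-convex, hence constant. Therefore \<open>\<beta>\<close> is a positive combination of exponentials.
  Since \<open>F\<close> and then \<open>h\<close> are recovered from \<open>\<beta>\<close> by inverting \<open>g \<mapsto> \<integral> g(\<sqdot> + t) e\<^sup>-\<^sup>t dt\<close>, the same holds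
  for \<open>h\<close>.\<close>

section \<open>Exponentially convex functions with a linear recurrence\<close>

text \<open>This is \<open>p\<close> evaluated at the unit shift operator and applied to
  \<open>b\<close>, so products of polynomials become compositions (\<open>poly_shift_mult\<close>).
  The values lie in any real vector space because the action is used on real and on complex
  functions.\<close>

definition poly_shift :: "real poly \<Rightarrow> (real \<Rightarrow> 'a::real_vector) \<Rightarrow> real \<Rightarrow> 'a" where
  "poly_shift p b x = (\<Sum>i\<le>degree p. coeff p i *\<^sub>R b (x + real i))"

lemma poly_shift_eq_sum:
  assumes "degree p \<le> n"
  shows "poly_shift p b x = (\<Sum>i\<le>n. coeff p i *\<^sub>R b (x + real i))"
  unfolding poly_shift_def using assms
  by (intro sum.mono_neutral_left) (auto simp: coeff_eq_0)

lemma poly_shift_0 [simp]: "poly_shift 0 b x = 0"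
  by (simp add: poly_shift_def)

lemma poly_shift_pCons [simp]:
  "poly_shift (pCons a p) b x = a *\<^sub>R b x + poly_shift p b (x + 1)"
proof -
  have "poly_shift (pCons a p) b x
      = (\<Sum>i\<le>Suc (degree p). coeff (pCons a p) i *\<^sub>R b (x + real i))"
    by (rule poly_shift_eq_sum) (auto simp: degree_pCons_le)
  also have "\<dots> = a *\<^sub>R b x + (\<Sum>i\<le>degree p. coeff p i *\<^sub>R b (x + 1 + real i))"
    by (subst sum.atMost_Suc_shift) (simp add: algebra_simps)
  finally show ?thesis by (simp add: poly_shift_def)
qed

lemma poly_shift_1 [simp]: "poly_shift 1 b x = b x"
  by (simp add: one_pCons)

lemma poly_shift_add: "poly_shift (p + q) b x = poly_shift p b x + poly_shift q b x"
proof -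
  define n where "n = max (degree p) (degree q)"
  have "degree (p + q) \<le> n" "degree p \<le> n" "degree q \<le> n"
    by (auto simp: n_def degree_add_le)
  then show ?thesis
    by (simp add: poly_shift_eq_sum[where n = n] scaleR_add_left sum.distrib)
qed

lemma poly_shift_smult: "poly_shift (smult c p) b x = c *\<^sub>R poly_shift p b x"
proof -
  have "degree (smult c p) \<le> degree p" by (rule degree_smult_le)
  then show ?thesis
    by (simp add: poly_shift_eq_sum[where n = "degree p"] scaleR_sum_right)
qed

lemma poly_shift_diff: "poly_shift (p - q) b x = poly_shift p b x - poly_shift q b x"
  using poly_shift_add[of p "smult (-1) q" b x] poly_shift_smult[of "-1" q b x] by simp

lemma poly_shift_sum:
  "poly_shift (\<Sum>i\<in>I. p i) b x = (\<Sum>i\<in>I. poly_shift (p i) b x)"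
  by (induction I rule: infinite_finite_induct) (auto simp: poly_shift_add)

lemma smult_eq_const_mult: "smult c p = [:c:] * (p :: 'a::comm_ring_1 poly)"
  by simp

lemma poly_shift_mult: "poly_shift (p * q) b x = poly_shift p (poly_shift q b) x"
proof (induction p arbitrary: x)
  case (pCons a p)
  then show ?case by (simp add: poly_shift_add poly_shift_smult)
qed simp

text \<open>A complex root exists by the fundamental theorem of algebra. A real root splits off a
  linear factor; a non-real one, with its conjugate, the quadratic \<open>(X - a)^2 + b^2\<close>, a
  sum of squares that \<open>annihilates_cancel_quadratic\<close> exploits.\<close>

lemma real_poly_factor:
  fixes r :: "real poly"
  assumes "degree r > 0"
  obtains (linear) l s where "r = [:-l, 1:] * s"
    | (quadratic) a b s where "b \<noteq> 0" "r = [:a\<^sup>2 + b\<^sup>2, -2 * a, 1:] * s"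
proof -
  define R where "R = map_poly complex_of_real r"
  have "degree R = degree r"
    by (simp add: R_def degree_map_poly)
  then have "\<not> constant (poly R)"
    using assms by (simp add: constant_degree)
  then obtain z where z: "poly R z = 0"
    using fundamental_theorem_of_algebra by blast
  have ev: "poly (map_poly complex_of_real p) (complex_of_real x) = of_real (poly p x)" for p x
    by (induction p) (auto simp: map_poly_pCons)
  have hom: "map_poly complex_of_real (p * q) = map_poly complex_of_real p * map_poly complex_of_real q"
    "map_poly complex_of_real (p + q) = map_poly complex_of_real p + map_poly complex_of_real q" for p q
    by (auto intro!: poly_eqI simp: coeff_map_poly coeff_mult)
  show ?thesis
  proof (cases "Im z = 0")
    case True
    then have "poly r (Re z) = 0"
      using z ev[of r "Re z"] by (simp add: R_def complex_is_Real_iff of_real_Re)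
    then show ?thesis
      using linear by (metis dvdE poly_eq_0_iff_dvd)
  next
    case False
    define a b where "a = Re z" and "b = Im z"
    define Q where "Q = [:a\<^sup>2 + b\<^sup>2, -2 * a, 1:]"
    have "b \<noteq> 0" using False by (simp add: b_def)
    have Qz: "poly (map_poly complex_of_real Q) z = 0"
      by (simp add: Q_def a_def b_def map_poly_pCons complex_eq_iff power2_eq_square algebra_simps)
    \<comment> \<open>The remainder is at most linear with real coefficients and vanishes at the
      non-real number \<open>z\<close>, so it is zero.\<close>
    define m where "m = r mod Q"
    have rQ: "r = Q * (r div Q) + m" by (simp add: m_def)
    have "poly (map_poly complex_of_real m) z = 0"
      using z Qz unfolding R_def by (subst (asm) rQ) (simp add: hom)
    moreover have "degree m < 2 \<or> m = 0"
      using degree_mod_less[of Q r] by (auto simp: Q_def m_def)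
    then have "m = [:coeff m 0, coeff m 1:]"
      by (intro poly_eqI) (auto simp: coeff_pCons coeff_eq_0 split: nat.splits)
    then obtain u w where m: "m = [:u, w:]" by blast
    ultimately have "of_real u + of_real w * z = 0"
      by (simp add: map_poly_pCons mult.commute)
    then have "w * b = 0" "u + w * a = 0"
      by (auto simp: complex_eq_iff a_def b_def)
    then have "m = 0" using \<open>b \<noteq> 0\<close> m by simp
    then show ?thesis
      using quadratic[OF \<open>b \<noteq> 0\<close>] rQ by (simp add: Q_def)
  qed
qed

lemma nonneg_quadratic_discriminant:
  fixes a b c :: real
  assumes "\<And>s. a + 2 * s * b + s\<^sup>2 * c \<ge> 0"
  shows "b\<^sup>2 \<le> a * c"
proof (cases "c = 0")
  case True
  have "b = 0"
  proof (rule ccontr)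
    assume "b \<noteq> 0"
    \<comment> \<open>This point gives the linear function the value \<open>-1\<close>.\<close>
    then show False using assms[of "- (a + 1) / (2 * b)"] True by (simp add: field_simps)
  qed
  then show ?thesis using True by simp
next
  case False
  have "c > 0"
  proof (rule ccontr)
    assume "\<not> c > 0"
    then have c: "c < 0" using False by simp
    have "a \<ge> 0" using assms[of 0] by simp
    \<comment> \<open>Chosen so that \<open>s \<ge> 1\<close> and
      \<open>2 * b + s * c \<le> -1 - a\<close>, which makes the quadratic at most
      \<open>-1\<close>.\<close>
    define s where "s = (1 + 2 * \<bar>b\<bar> + a) / (-c) + 1"
    have s1: "s \<ge> 1" using c \<open>a \<ge> 0\<close> by (simp add: s_def divide_nonneg_neg)
    have sc: "s * c = -(1 + 2 * \<bar>b\<bar> + a) + c" using c by (simp add: s_def field_simps)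
    have "s * (2 * b + s * c) \<le> s * (-1 - a)"
      using s1 sc c by (intro mult_left_mono) auto
    moreover have "s * (-1 - a) \<le> 1 * (-1 - a)"
      using s1 \<open>a \<ge> 0\<close> by (intro mult_right_mono_neg) auto
    ultimately show False using assms[of s] by (simp add: power2_eq_square algebra_simps)
  qed
  then show ?thesis using assms[of "- b / c"] by (simp add: field_simps power2_eq_square)
qed

text \<open>By periodicity a maximum exists, at \<open>u\<close> say. Convexity at a translate
  \<open>w\<close> of \<open>u\<close>, the midpoint of \<open>x\<close> and
  \<open>2 * w - x\<close>, bounds \<open>(f u)^2\<close> by \<open>f x * f u\<close>, so
  \<open>f x\<close> is maximal too.\<close>

lemma periodic_log_convex_const:
  fixes f :: "real \<Rightarrow> real"
  assumes cont: "continuous_on {0<..} f"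
    and nonneg: "\<And>x. x > 0 \<Longrightarrow> f x \<ge> 0"
    and periodic: "\<And>x. x > 0 \<Longrightarrow> f (x + 1) = f x"
    and convex: "\<And>x y. x > 0 \<Longrightarrow> y > 0 \<Longrightarrow> (f (x + y))\<^sup>2 \<le> f (2 * x) * f (2 * y)"
  shows "\<exists>M. \<forall>x>0. f x = M"
proof -
  have per: "f (x + real n) = f x" if "x > 0" for x n
  proof (induction n)
    case (Suc n)
    then show ?case using periodic[of "x + real n"] that by (simp add: algebra_simps)
  qed simp
  have "continuous_on {1..2} f" using cont by (rule continuous_on_subset) auto
  then obtain u where u: "u \<in> {1..2}" "\<And>y. y \<in> {1..2} \<Longrightarrow> f y \<le> f u"
    using continuous_attains_sup[of "{1..2::real}" f] by auto
  have le: "f x \<le> f u" if "x > 0" for x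
  proof -
    \<comment> \<open>A representative modulo 1 inside the compact interval on which the maximum was
      taken, away from 0.\<close>
    define y where "y = frac x + 1"
    have y: "y \<in> {1..2}" using frac_lt_1[of x] by (auto simp: y_def intro: less_imp_le)
    have "x + 1 = y + real (nat \<lfloor>x\<rfloor>)" using that by (simp add: y_def frac_def)
    then have "f x = f y" using per[of y "nat \<lfloor>x\<rfloor>"] periodic[OF that] y by simp
    then show ?thesis using u(2)[OF y] by simp
  qed
  have "f x = f u" if "x > 0" for x
  proof -
    obtain n where n: "real n > x" using reals_Archimedean2 by blast
    \<comment> \<open>Translating the maximum point beyond \<open>x\<close> keeps the reflected
      point \<open>2 * w - x\<close> positive.\<close>
    define w where "w = u + real n"
    have w: "f w = f u" "w > x" using per[of u n] u(1) n by (auto simp: w_def)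
    have "(f w)\<^sup>2 \<le> f x * f (2 * w - x)"
      using convex[of "x / 2" "w - x / 2"] that w(2) by (simp add: algebra_simps)
    also have "\<dots> \<le> f x * f u"
      using nonneg[OF that] le w(2) that by (intro mult_left_mono) auto
    finally have "f u = 0 \<or> f u \<le> f x"
      using w(1) nonneg[of u] u(1) by (auto simp: power2_eq_square mult_le_cancel_right)
    then show ?thesis using le[OF that] nonneg[OF that] by linarith
  qed
  then show ?thesis by blast
qed

text \<open>\<open>form_nonneg\<close> is the quadratic form of the kernel
  \<open>\<beta>(a + b)\<close> with the coefficients of \<open>p\<close> as weights at the points
  \<open>x + i\<close> and those of \<open>q\<close> at the points \<open>y + j\<close>; polynomial
  products collect the double sums. The two independent offsets yield Cauchy-Schwarz between
  different points.\<close>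

locale exp_convex =
  fixes \<beta> :: "real \<Rightarrow> real"
  assumes form_nonneg: "\<And>p q x y. x \<ge> 0 \<Longrightarrow> y \<ge> 0 \<Longrightarrow>
      poly_shift (p * p) \<beta> (2 * x) + 2 * poly_shift (p * q) \<beta> (x + y)
        + poly_shift (q * q) \<beta> (2 * y) \<ge> 0"
    and cont: "continuous_on {0<..} \<beta>"
begin

section \<open>Cauchy-Schwarz inequality and the annihilator of \<beta>\<close>

lemma square_nonneg:
  assumes "x \<ge> 0"
  shows "poly_shift (p * p) \<beta> x \<ge> 0"
  using form_nonneg[of "x / 2" 0 p 0] assms by simp

text \<open>Replacing \<open>q\<close> by \<open>s q\<close> gives a quadratic in \<open>s\<close>
  that is nowhere negative, so its discriminant is not positive.\<close>

lemma cauchy_schwarz: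
  assumes "x \<ge> 0" "y \<ge> 0"
  shows "(poly_shift (p * q) \<beta> (x + y))\<^sup>2
    \<le> poly_shift (p * p) \<beta> (2 * x) * poly_shift (q * q) \<beta> (2 * y)"
proof (rule nonneg_quadratic_discriminant)
  fix s
  show "0 \<le> poly_shift (p * p) \<beta> (2 * x) + 2 * s * poly_shift (p * q) \<beta> (x + y)
      + s\<^sup>2 * poly_shift (q * q) \<beta> (2 * y)"
    using form_nonneg[OF assms, of p "smult s q"]
    by (simp add: poly_shift_smult power2_eq_square mult.assoc)
qed

definition annihilates :: "real poly \<Rightarrow> bool" where
  "annihilates p \<longleftrightarrow> (\<forall>x>0. poly_shift p \<beta> x = 0)"

lemma annihilates_mult:
  assumes "annihilates p"
  shows "annihilates (q * p)"
  using assms by (auto simp: annihilates_def poly_shift_mult poly_shift_def[of q])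

text \<open>Null vectors of a semidefinite form lie in its kernel: Cauchy-Schwarz of
  \<open>p\<close> against the constant polynomial 1.\<close>

lemma annihilates_if_square_0:
  assumes "\<And>x. x > 0 \<Longrightarrow> poly_shift (p * p) \<beta> x = 0"
  shows "annihilates p"
  unfolding annihilates_def
proof (intro allI impI)
  fix x :: real assume "x > 0"
  then have "(poly_shift p \<beta> x)\<^sup>2 \<le> 0"
    using cauchy_schwarz[of "x / 2" "x / 2" p 1] assms[of x] by simp
  then show "poly_shift p \<beta> x = 0" by simp
qed

text \<open>A further factor \<open>q\<close> completes the square of \<open>q * p\<close>. This is
  how multiple roots are reduced to simple ones.\<close>

lemma annihilates_sqrt:
  assumes "annihilates (q * (p * p))"
  shows "annihilates (q * p)"
proof -
  have "annihilates (q * (q * (p * p)))" using assms by (rule annihilates_mult)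
  then show ?thesis
    by (intro annihilates_if_square_0) (auto simp: annihilates_def ac_simps)
qed

text \<open>Multiplying by \<open>p\<close> gives the sum of the squares of \<open>(X - a) p\<close>
  and \<open>b p\<close>. Both act on \<beta> with non-negative values, so both vanish.\<close>

lemma annihilates_cancel_quadratic:
  assumes "annihilates (p * [:a\<^sup>2 + b\<^sup>2, -2 * a, 1:])" "b \<noteq> 0"
  shows "annihilates p"
proof (rule annihilates_if_square_0)
  fix x :: real assume x: "x > 0"
  define L where "L = [:-a, 1:] * p"
  have "annihilates (p * (p * [:a\<^sup>2 + b\<^sup>2, -2 * a, 1:]))"
    using assms(1) by (rule annihilates_mult)
  moreover have "[:a\<^sup>2 + b\<^sup>2, -2 * a, 1:] = [:-a, 1:] * [:-a, 1:] + [:b\<^sup>2:]"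
    by (simp add: power2_eq_square)
  then have "p * (p * [:a\<^sup>2 + b\<^sup>2, -2 * a, 1:]) = L * L + smult (b\<^sup>2) (p * p)"
    unfolding L_def smult_eq_const_mult by (simp only: algebra_simps)
  ultimately have "poly_shift (L * L) \<beta> x + b\<^sup>2 * poly_shift (p * p) \<beta> x = 0"
    using x by (simp add: annihilates_def poly_shift_add poly_shift_smult)
  moreover have "poly_shift (L * L) \<beta> x \<ge> 0" "poly_shift (p * p) \<beta> x \<ge> 0"
    using square_nonneg x by auto
  ultimately show "poly_shift (p * p) \<beta> x = 0"
    using assms(2) by (smt (verit) mult_pos_pos zero_less_power2)
qed

text \<open>The function \<open>\<gamma>\<close> is non-negative, yet one unit step multiplies it by
  \<open>l \<le> 0\<close>, so it vanishes beyond 1. Log-convexity carries the zeros down to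
  0.\<close>

lemma annihilates_cancel_nonpos_root:
  assumes "annihilates (p * [:-l, 1:])" "l \<le> 0"
  shows "annihilates p"
proof (rule annihilates_if_square_0)
  fix x :: real assume x: "x > 0"
  define \<gamma> where "\<gamma> = poly_shift (p * p) \<beta>"
  have "annihilates (p * (p * [:-l, 1:]))"
    using assms(1) by (rule annihilates_mult)
  then have eq: "\<gamma> (y + 1) = l * \<gamma> y" if "y > 0" for y
  proof -
    have "poly_shift (p * (p * [:-l, 1:])) \<beta> y = 0"
      using that \<open>annihilates (p * (p * [:-l, 1:]))\<close> by (simp only: annihilates_def)
    also have "p * (p * [:-l, 1:]) = [:-l, 1:] * (p * p)" by (simp only: ac_simps)
    finally show ?thesis unfolding poly_shift_mult[of "[:-l, 1:]"] by (simp add: \<gamma>_def)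
  qed
  have nonneg: "\<gamma> y \<ge> 0" if "y \<ge> 0" for y
    using square_nonneg that by (simp add: \<gamma>_def)
  have 1: "\<gamma> y = 0" if "y > 1" for y
    using eq[of "y - 1"] nonneg[of "y - 1"] nonneg[of y] that \<open>l \<le> 0\<close>
    by (smt (verit) mult_nonpos_nonneg)
  \<comment> \<open>Repeated halving: the square of \<open>\<gamma> y\<close> is at most
    \<open>\<gamma> 0 * \<gamma> (2 * y)\<close>.\<close>
  have "\<gamma> y = 0" if "y > 1 / 2 ^ n" for y n
    using that
  proof (induction n arbitrary: y)
    case 0
    then show ?case using 1 by simp
  next
    case (Suc n)
    then have "2 * y > 1 / 2 ^ n" by (simp add: field_simps)
    then have "\<gamma> (2 * y) = 0" using Suc.IH by blast
    moreover have "y > 0" using Suc.prems by (smt (verit) divide_nonneg_nonneg zero_le_power)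
    ultimately have "(\<gamma> y)\<^sup>2 \<le> 0"
      using cauchy_schwarz[of 0 y p p] by (simp add: \<gamma>_def)
    then show ?case by simp
  qed
  moreover obtain n where "1 / 2 ^ n < x"
    using x real_arch_pow_inv[of x "1 / 2"] by (auto simp: power_one_over)
  ultimately show "poly_shift (p * p) \<beta> x = 0" unfolding \<gamma>_def by blast
qed

text \<open>\<open>Z\<close> collects the distinct positive roots found so far and \<open>r\<close>
  is the unprocessed factor. Induction on its degree: quadratic factors, roots
  \<open>\<le> 0\<close> and repeated roots are dropped, a new positive root moves into
  \<open>Z\<close>.\<close>

lemma annihilates_split:
  assumes "annihilates ((\<Prod>l\<in>Z. [:-l, 1:]) * r)" "r \<noteq> 0" "finite Z" "Z \<subseteq> {0<..}"
  shows "\<exists>Z'. finite Z' \<and> Z' \<subseteq> {0<..} \<and> annihilates (\<Prod>l\<in>Z'. [:-l, 1:])"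
  using assms
proof (induction "degree r" arbitrary: r Z rule: less_induct)
  case less
  show ?case
  proof (cases "degree r > 0")
    case False
    then obtain c where c: "r = [:c:]" using degree_eq_zeroE by auto
    then have "c \<noteq> 0" using less.prems by auto
    then have "annihilates (\<Prod>l\<in>Z. [:-l, 1:])"
      using annihilates_mult[OF less.prems(1), of "[:1 / c:]"] c by simp
    then show ?thesis using less.prems by blast
  next
    case True
    then show ?thesis
    proof (cases rule: real_poly_factor)
      case (quadratic a b s)
      then have "annihilates (((\<Prod>l\<in>Z. [:-l, 1:]) * s) * [:a\<^sup>2 + b\<^sup>2, -2 * a, 1:])"
        using less.prems(1) by (simp only: ac_simps)
      then have "annihilates ((\<Prod>l\<in>Z. [:-l, 1:]) * s)"
        using annihilates_cancel_quadratic quadratic(1) by blast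
      moreover have "s \<noteq> 0" using quadratic less.prems(2) by auto
      moreover have "degree s < degree r"
        using quadratic \<open>s \<noteq> 0\<close> by (simp add: degree_mult_eq del: mult_pCons_left)
      ultimately show ?thesis using less.hyps less.prems by blast
    next
      case (linear l s)
      have s: "s \<noteq> 0" using linear less.prems(2) by auto
      have deg: "degree s < degree r"
        using linear \<open>s \<noteq> 0\<close> by (simp add: degree_mult_eq del: mult_pCons_left)
      show ?thesis
      proof (cases "l \<le> 0")
        case True
        have "annihilates (((\<Prod>l\<in>Z. [:-l, 1:]) * s) * [:-l, 1:])"
          using less.prems(1) linear by (simp only: ac_simps)
        then have "annihilates ((\<Prod>l\<in>Z. [:-l, 1:]) * s)"
          using annihilates_cancel_nonpos_root True by blast
        then show ?thesis using less.hyps less.prems s deg by blast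
      next
        case False
        show ?thesis
        proof (cases "l \<in> Z")
          case True
          \<comment> \<open>One factor comes from \<open>Z\<close> and one from \<open>r\<close>;
            together they form the square that \<open>annihilates_sqrt\<close> reduces.\<close>
          define q where "q = (\<Prod>l\<in>Z - {l}. [:-l, 1:])"
          have q: "(\<Prod>l\<in>Z. [:-l, 1:]) = [:-l, 1:] * q"
            unfolding q_def using True less.prems(3) by (rule prod.remove[rotated])
          have "annihilates ((q * s) * ([:-l, 1:] * [:-l, 1:]))"
            using less.prems(1) linear q by (simp only: ac_simps)
          then have "annihilates ((q * s) * [:-l, 1:])" by (rule annihilates_sqrt)
          then have "annihilates ((\<Prod>l\<in>Z. [:-l, 1:]) * s)" using q by (simp only: ac_simps)
          then show ?thesis using less.hyps less.prems s deg by blast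
        next
          case False
          have "annihilates ((\<Prod>l\<in>insert l Z. [:-l, 1:]) * s)"
            using less.prems(1,3) linear False
            by (simp add: prod.insert mult.assoc mult.left_commute del: mult_pCons_left mult_pCons_right)
          moreover have "insert l Z \<subseteq> {0<..}" using \<open>\<not> l \<le> 0\<close> less.prems(4) by auto
          ultimately show ?thesis using less.hyps less.prems(3) s deg by blast
        qed
      qed
    qed
  qed
qed

text \<open>On \<beta> the polynomial \<open>p\<close> acts like a projection onto the eigenspace of
  the shift for \<open>l\<close>. Since \<open>p\<close> and \<open>p * p\<close> act alike, the
  component is non-negative and log-convex; dividing by \<open>l powr x\<close> makes it
  periodic.\<close>

lemma eigen_component:
  assumes l: "l > 0" and ann: "annihilates ([:-l, 1:] * p)" and idem: "annihilates (p * (p - 1))"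
  shows "\<exists>c\<ge>0. \<forall>x>0. poly_shift p \<beta> x = c * l powr x"
proof -
  define \<gamma> where "\<gamma> = poly_shift p \<beta>"
  have sq: "\<gamma> x = poly_shift (p * p) \<beta> x" if "x > 0" for x
    using idem that by (simp add: annihilates_def \<gamma>_def algebra_simps poly_shift_diff)
  have step: "\<gamma> (x + 1) = l * \<gamma> x" if "x > 0" for x
    using ann that poly_shift_mult[of "[:-l, 1:]" p \<beta> x]
    by (simp add: annihilates_def \<gamma>_def del: mult_pCons_left)
  have "\<exists>M. \<forall>x>0. \<gamma> x * l powr (-x) = M"
  proof (rule periodic_log_convex_const)
    show "continuous_on {0<..} (\<lambda>x. \<gamma> x * l powr (-x))"
      unfolding \<gamma>_def poly_shift_def using l
      by (intro continuous_intros continuous_on_compose2[OF cont]) auto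
    show "0 \<le> \<gamma> x * l powr (-x)" if "x > 0" for x
      using that sq square_nonneg by simp
    show "\<gamma> (x + 1) * l powr (-(x + 1)) = \<gamma> x * l powr (-x)" if "x > 0" for x
      using step[OF that] l powr_add[of l 1 "-(x+1)"] by simp
    show "(\<gamma> (x + y) * l powr (- (x + y)))\<^sup>2
        \<le> \<gamma> (2 * x) * l powr (- (2 * x)) * (\<gamma> (2 * y) * l powr (- (2 * y)))"
      if "x > 0" "y > 0" for x y
    proof -
      have "(l powr (- (x + y)))\<^sup>2 = l powr (- (2 * x)) * l powr (- (2 * y))"
        by (simp add: power2_eq_square powr_add[symmetric])
      moreover have "(\<gamma> (x + y))\<^sup>2 \<le> \<gamma> (2 * x) * \<gamma> (2 * y)"
        using that sq cauchy_schwarz[of x y p p] by simp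
      then have "(\<gamma> (x + y))\<^sup>2 * (l powr (- (2 * x)) * l powr (- (2 * y)))
          \<le> \<gamma> (2 * x) * \<gamma> (2 * y) * (l powr (- (2 * x)) * l powr (- (2 * y)))"
        by (rule mult_right_mono) simp
      ultimately show ?thesis by (simp only: power_mult_distrib ac_simps)
    qed
  qed
  then obtain M where M: "\<gamma> x * l powr (-x) = M" if "x > 0" for x by blast
  have "M \<ge> 0" using M[of 1] sq[of 1] square_nonneg[of 1 p] l by (auto simp: zero_le_mult_iff)
  moreover have "\<gamma> x = M * l powr x" if "x > 0" for x
    using M[OF that] l by (simp add: powr_minus field_simps)
  ultimately show ?thesis unfolding \<gamma>_def by blast
qed

text \<open>After reduction to an annihilator with simple positive roots \<open>Z\<close>, the
  Lagrange polynomials of \<open>Z\<close> add up to 1 and split \<beta> into its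
  eigencomponents.\<close>

theorem finite_exponential_sum:
  assumes "annihilates a" "a \<noteq> 0"
  shows "\<exists>Z c. finite Z \<and> Z \<subseteq> {0<..} \<and> (\<forall>l\<in>Z. c l \<ge> 0) \<and>
    (\<forall>x>0. \<beta> x = (\<Sum>l\<in>Z. c l * l powr x))"
proof -
  obtain Z where Z: "finite Z" "Z \<subseteq> {0<..}" and ann: "annihilates (\<Prod>l\<in>Z. [:-l, 1:])"
    using annihilates_split[of "{}" a] assms by auto
  \<comment> \<open>The Lagrange basis polynomial: 1 at \<open>l\<close> and 0 at the other points
    of \<open>Z\<close>.\<close>
  define L where "L l = smult (1 / (\<Prod>m\<in>Z - {l}. l - m)) (\<Prod>m\<in>Z - {l}. [:-m, 1:])" for l
  have eigen: "annihilates ([:-l, 1:] * L l)" if "l \<in> Z" for l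
  proof -
    have "[:-l, 1:] * L l = smult (1 / (\<Prod>m\<in>Z - {l}. l - m)) (\<Prod>m\<in>Z. [:-m, 1:])"
      unfolding L_def prod.remove[OF Z(1) that] by (simp only: mult_smult_right)
    then show ?thesis
      using ann by (simp add: annihilates_def poly_shift_smult del: mult_pCons_left)
  qed
  have L_same: "poly (L l) l = 1" for l
    using Z(1) by (simp add: L_def poly_prod)
  have L_other: "poly (L l) m = 0" if "m \<in> Z" "m \<noteq> l" for l m
    using that Z(1) by (auto simp: L_def poly_prod prod_zero_iff)
  have idem: "annihilates (L l * (L l - 1))" if "l \<in> Z" for l
  proof -
    \<comment> \<open>The factor \<open>L l - 1\<close> has the root \<open>l\<close>, so
      \<open>L l * (L l - 1)\<close> is a multiple of \<open>(X - l) L l\<close>, which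
      annihilates.\<close>
    have "[:-l, 1:] dvd L l - 1" using L_same by (simp add: poly_eq_0_iff_dvd[symmetric])
    then obtain s where "L l - 1 = [:-l, 1:] * s" by (auto elim: dvdE)
    then have "L l * (L l - 1) = s * ([:-l, 1:] * L l)" by (simp only: ac_simps)
    then show ?thesis using annihilates_mult[OF eigen[OF that]] by (simp only:)
  qed
  have "\<exists>c. \<forall>l\<in>Z. c l \<ge> 0 \<and> (\<forall>x>0. poly_shift (L l) \<beta> x = c l * l powr x)"
    using eigen_component[OF _ eigen idem] Z(2) by (intro bchoice) auto
  then obtain c where c: "\<And>l. l \<in> Z \<Longrightarrow> c l \<ge> 0"
    "\<And>l x. l \<in> Z \<Longrightarrow> x > 0 \<Longrightarrow> poly_shift (L l) \<beta> x = c l * l powr x" by blast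
  have "\<beta> x = (\<Sum>l\<in>Z. c l * l powr x)" if x: "x > 0" for x
  \<comment> \<open>For empty \<open>Z\<close> the annihilating product is 1, so \<beta> vanishes;
    the Lagrange sum would be 0 instead of 1.\<close>
  proof (cases "Z = {}")
    case True
    then show ?thesis using ann x by (simp add: annihilates_def)
  next
    case False
    \<comment> \<open>Both sides have degree below \<open>card Z\<close> and agree on
      \<open>Z\<close>.\<close>
    have "(\<Sum>l\<in>Z. L l) = 1"
    proof (rule poly_eqI_degree)
      show "poly (\<Sum>l\<in>Z. L l) m = poly 1 m" if "m \<in> Z" for m
      proof -
        have "(\<Sum>l\<in>Z. poly (L l) m) = (\<Sum>l\<in>Z. if l = m then 1 else 0)"
          using L_same L_other that by (intro sum.cong) auto
        then show ?thesis using that Z(1) by (simp add: poly_sum)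
      qed
      show "card Z > degree (1 :: real poly)" using False Z(1) by (simp add: card_gt_0_iff)
      have "degree (L l) \<le> card Z - 1" if "l \<in> Z" for l
      proof -
        have "degree (L l) \<le> degree (\<Prod>m\<in>Z - {l}. [:-m, 1:])"
          unfolding L_def by (rule degree_smult_le)
        also have "\<dots> \<le> (\<Sum>m\<in>Z - {l}. degree [:-m, 1:])"
          using degree_prod_sum_le[of "Z - {l}" "\<lambda>m. [:-m, 1:]"] Z(1) by (simp add: comp_def)
        finally show ?thesis using that Z(1) by simp
      qed
      then have "degree (\<Sum>l\<in>Z. L l) \<le> card Z - 1" using Z(1) by (intro degree_sum_le) auto
      then show "card Z > degree (\<Sum>l\<in>Z. L l)"
        using False Z(1) by (simp add: card_gt_0_iff order.strict_trans1)
    qed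
    then have "\<beta> x = poly_shift (\<Sum>l\<in>Z. L l) \<beta> x" by simp
    also have "\<dots> = (\<Sum>l\<in>Z. c l * l powr x)"
      using c(2) x by (simp add: poly_shift_sum)
    finally show ?thesis .
  qed
  then show ?thesis using Z c(1) by blast
qed

end

section \<open>Tail integrals on the half-line\<close>

lemma lebesgue_translate: "distr lebesgue lebesgue ((+) x) = (lebesgue :: real measure)"
  using lebesgue_real_affine[of 1 x] by (simp add: density_1)

lemma measurable_translate_lebesgue: "(+) (x :: real) \<in> lebesgue \<rightarrow>\<^sub>M lebesgue"
  using lebesgue_affine_measurable[of "\<lambda>_. 1" x] by simp

lemma measurable_translate_ray:
  "(+) x \<in> lebesgue_on {0<..} \<rightarrow>\<^sub>M lebesgue_on {x::real<..}"
  by (intro measurable_restrict_space3 measurable_translate_lebesgue) auto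

text \<open>Translation invariance of Lebesgue measure; the preimage of a subset of the ray already
  lies in the half-line. This is the substitution rule behind \<open>AE_translate\<close> and
  \<open>integral_translate\<close>.\<close>

lemma distr_translate_ray:
  "distr (lebesgue_on {0<..}) (lebesgue_on {x<..}) ((+) x) = lebesgue_on {x::real<..}"
proof (rule measure_eqI)
  fix A assume "A \<in> sets (distr (lebesgue_on {0<..}) (lebesgue_on {x<..}) ((+) x))"
  then have A: "A \<in> sets (lebesgue_on {x<..})" by simp
  then have A': "A \<in> sets lebesgue" "A \<subseteq> {x<..}" by (auto simp: sets_restrict_space_iff)
  have eq: "(+) x -` A \<inter> {0<..} = (+) x -` A" using A'(2) by auto
  have "emeasure (distr (lebesgue_on {0<..}) (lebesgue_on {x<..}) ((+) x)) A
      = emeasure lebesgue ((+) x -` A)"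
    using A'(2) unfolding emeasure_distr[OF measurable_translate_ray A]
    by (subst emeasure_restrict_space) (auto simp: eq)
  also have "\<dots> = emeasure (distr lebesgue lebesgue ((+) x)) A"
    by (subst emeasure_distr[OF measurable_translate_lebesgue A'(1)]) simp
  also have "\<dots> = emeasure (lebesgue_on {x<..}) A"
    using A' by (simp add: lebesgue_translate emeasure_restrict_space)
  finally show "emeasure (distr (lebesgue_on {0<..}) (lebesgue_on {x<..}) ((+) x)) A
      = emeasure (lebesgue_on {x<..}) A" .
qed simp

section \<open>Measurability, null sets and integration on rays\<close>

lemma space_half_line [simp]: "space half_line = {0<..}"
  by (simp add: half_line_def)

lemma ray_eq_restrict_half_line:
  "x \<ge> 0 \<Longrightarrow> lebesgue_on {x<..} = restrict_space half_line {x<..}"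
  by (auto simp: half_line_def restrict_restrict_space intro!: arg_cong[where f = "restrict_space lebesgue"])

lemma ray_in_sets_half_line: "x \<ge> 0 \<Longrightarrow> {x<..} \<in> sets half_line"
  by (auto simp: half_line_def sets_restrict_space_iff)

lemma measurable_ray:
  assumes "f \<in> borel_measurable half_line" "x \<ge> 0"
  shows "f \<in> borel_measurable (lebesgue_on {x<..})"
  using assms measurable_restrict_space1 by (auto simp: ray_eq_restrict_half_line)

lemma measurable_translate:
  assumes "f \<in> borel_measurable half_line" "x \<ge> 0"
  shows "(\<lambda>t. f (x + t)) \<in> borel_measurable half_line"
  using measurable_compose[OF measurable_translate_ray measurable_ray[OF assms]]
  by (simp add: half_line_def)

lemma measurable_half_line_lebesgue:
  "f \<in> borel_measurable lebesgue \<Longrightarrow> f \<in> borel_measurable half_line"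
  unfolding half_line_def by (rule measurable_restrict_space1)

lemma measurable_half_line_continuous:
  fixes f :: "real \<Rightarrow> 'a::topological_space"
  assumes "continuous_on UNIV f"
  shows "f \<in> borel_measurable half_line"
  using borel_measurable_continuous_onI[OF assms]
  by (intro measurable_half_line_lebesgue) (simp add: measurable_completion)

lemma AE_half_line_iff: "(AE t in half_line. P t) \<longleftrightarrow> (AE t in lebesgue. t > 0 \<longrightarrow> P t)"
  unfolding half_line_def by (subst AE_restrict_space_iff) auto

lemma AE_translate:
  assumes "AE t in half_line. P t" "x \<ge> 0"
  shows "AE t in half_line. P (x + t)"
proof -
  have "AE t in lebesgue_on {x<..}. P t"
    using assms unfolding AE_half_line_iff by (subst AE_restrict_space_iff) (auto elim!: eventually_mono)
  then have "AE t in distr (lebesgue_on {0<..}) (lebesgue_on {x<..}) ((+) x). P t"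
    by (simp only: distr_translate_ray)
  from AE_distrD[OF measurable_translate_ray this] show ?thesis
    by (simp only: half_line_def)
qed

lemma integrable_translate_iff:
  fixes f :: "real \<Rightarrow> 'a::{banach, second_countable_topology}"
  assumes "f \<in> borel_measurable (lebesgue_on {x<..})"
  shows "integrable half_line (\<lambda>t. f (x + t)) \<longleftrightarrow> integrable (lebesgue_on {x<..}) f"
  using integrable_distr_eq[OF measurable_translate_ray assms]
  by (simp add: distr_translate_ray half_line_def)

lemma integral_translate:
  fixes f :: "real \<Rightarrow> 'a::{banach, second_countable_topology}"
  assumes "f \<in> borel_measurable (lebesgue_on {x<..})"
  shows "(LINT t|half_line. f (x + t)) = (LINT t|lebesgue_on {x<..}. f t)"
  using integral_distr[OF measurable_translate_ray assms]
  by (simp add: distr_translate_ray half_line_def)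

lemma integrable_ray_iff:
  fixes f :: "real \<Rightarrow> 'a::{banach, second_countable_topology}"
  assumes "0 \<le> a" "a \<le> b"
  shows "integrable (lebesgue_on {b<..}) f
    \<longleftrightarrow> integrable (lebesgue_on {a<..}) (\<lambda>t. indicator {b<..} t *\<^sub>R f t)"
proof -
  have "lebesgue_on {b<..} = restrict_space (lebesgue_on {a<..}) {b<..}"
    using assms by (auto simp: restrict_restrict_space intro!: arg_cong[where f = "restrict_space lebesgue"])
  then show ?thesis using assms by (auto simp: integrable_restrict_space sets_restrict_space_iff Int_absorb1)
qed

text \<open>Turning the ray into an indicator places tails with varying endpoints on one measure
  space, as dominated convergence demands.\<close>

lemma integral_ray:
  fixes f :: "real \<Rightarrow> 'a::{banach, second_countable_topology}"
  assumes "0 \<le> a" "a \<le> b"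
  shows "(LINT t|lebesgue_on {b<..}. f t) = (LINT t|lebesgue_on {a<..}. indicator {b<..} t *\<^sub>R f t)"
proof -
  have "lebesgue_on {b<..} = restrict_space (lebesgue_on {a<..}) {b<..}"
    using assms by (auto simp: restrict_restrict_space intro!: arg_cong[where f = "restrict_space lebesgue"])
  then show ?thesis using assms by (auto simp: integral_restrict_space sets_restrict_space_iff Int_absorb1)
qed

lemma integrable_ray_mono:
  fixes f :: "real \<Rightarrow> 'a::{banach, second_countable_topology}"
  assumes "integrable (lebesgue_on {a<..}) f" "0 \<le> a" "a \<le> b"
  shows "integrable (lebesgue_on {b<..}) f"
  unfolding integrable_ray_iff[OF assms(2,3)] using assms
  by (intro integrable_mult_indicator) (auto simp: sets_restrict_space_iff)

text \<open>A non-empty open interval has positive measure and so meets every set of full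
  measure.\<close>

lemma AE_half_line_ex:
  assumes "AE t in half_line. P t" "0 \<le> a" "a < b"
  shows "\<exists>t. a < t \<and> t < b \<and> P t"
proof (rule ccontr)
  assume neg: "\<not> ?thesis"
  from assms(1) have "AE t in lebesgue. t > 0 \<longrightarrow> P t"
    by (simp only: AE_half_line_iff)
  then have "AE t in lebesgue. t \<notin> {a<..<b}"
    by eventually_elim (use neg assms(2,3) in auto)
  then have "{a<..<b} \<in> null_sets lebesgue"
    by (subst AE_iff_null_sets) auto
  then show False using assms(3) by (simp add: null_sets_def)
qed

text \<open>Dominated convergence with majorant \<open>norm (f t)\<close>: when the endpoints tend
  to \<open>a\<close>, the indicators converge at every \<open>t \<noteq> a\<close>.\<close>

lemma continuous_tail_integral:
  fixes f :: "real \<Rightarrow> 'a::{banach, second_countable_topology}"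
  assumes int: "\<And>x. x > 0 \<Longrightarrow> integrable (lebesgue_on {x<..}) f"
  shows "continuous_on {0<..} (\<lambda>x. LINT t|lebesgue_on {x<..}. f t)"
proof -
  \<comment> \<open>Integrability is given only away from 0, so continuity is proved beyond each
    \<open>c > 0\<close> first.\<close>
  have *: "continuous_on {c<..} (\<lambda>x. LINT t|lebesgue_on {x<..}. f t)" if c: "c > 0" for c
  proof (rule continuous_on_sequentiallyI)
    fix u :: "nat \<Rightarrow> real" and a
    assume u: "\<forall>n. u n \<in> {c<..}" and a: "a \<in> {c<..}" and lim: "u \<longlonglongrightarrow> a"
    let ?M = "lebesgue_on {c<..}"
    have "(\<lambda>n. LINT t|?M. indicator {u n<..} t *\<^sub>R f t) \<longlonglongrightarrow> (LINT t|?M. indicator {a<..} t *\<^sub>R f t)"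
    proof (rule integral_dominated_convergence[where w = "\<lambda>t. norm (f t)"])
      have [measurable]: "f \<in> borel_measurable ?M" using int[OF c] by auto
      have m: "{x<..} \<inter> space ?M \<in> sets ?M" for x by (auto simp: sets_restrict_space_iff)
      have meas: "(\<lambda>t. indicator {x<..} t *\<^sub>R f t) \<in> borel_measurable ?M" for x
        using m[of x] by (intro borel_measurable_scaleR) (auto simp: borel_measurable_indicator_iff)
      show "(\<lambda>t. indicator {a<..} t *\<^sub>R f t) \<in> borel_measurable ?M"
        "(\<lambda>t. indicator {u n<..} t *\<^sub>R f t) \<in> borel_measurable ?M" for n
        by (rule meas)+
      show "integrable ?M (\<lambda>t. norm (f t))" using int[OF c] by simp
      have "AE t in lebesgue. t \<noteq> a" by (intro AE_completion AE_lborel_singleton)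
      then have "AE t in ?M. t \<noteq> a" by (auto simp: AE_restrict_space_iff elim!: eventually_mono)
      then show "AE t in ?M. (\<lambda>n. indicator {u n<..} t *\<^sub>R f t) \<longlonglongrightarrow> indicator {a<..} t *\<^sub>R f t"
      proof eventually_elim
        case (elim t)
        have "eventually (\<lambda>n. (u n < t) = (a < t)) sequentially"
        proof (cases "a < t")
          case True
          then show ?thesis using order_tendstoD(2)[OF lim True] by (auto elim!: eventually_mono)
        next
          case False
          then have "t < a" using elim by simp
          then show ?thesis using order_tendstoD(1)[OF lim \<open>t < a\<close>] by (auto elim!: eventually_mono)
        qed
        then show ?case
          by (intro tendsto_eventually) (auto elim!: eventually_mono simp: indicator_def)
      qed
    qed (auto simp: indicator_def)
    moreover have "(LINT t|lebesgue_on {x<..}. f t) = (LINT t|?M. indicator {x<..} t *\<^sub>R f t)"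
      if "x > c" for x using integral_ray[of c x f] that c by simp
    ultimately show "(\<lambda>n. LINT t|lebesgue_on {u n<..}. f t) \<longlonglongrightarrow> (LINT t|lebesgue_on {a<..}. f t)"
      using u a by simp
  qed
  show ?thesis
  proof (rule continuous_at_imp_continuous_on, rule ballI)
    fix x :: real assume "x \<in> {0<..}"
    then show "isCont (\<lambda>x. LINT t|lebesgue_on {x<..}. f t) x"
      using *[of "x / 2"] by (simp add: continuous_on_eq_continuous_at)
  qed
qed

lemma tail_integral_tendsto_0:
  fixes f :: "real \<Rightarrow> 'a::{banach, second_countable_topology}"
  assumes int: "integrable half_line f"
  shows "(\<lambda>n. LINT t|lebesgue_on {real n<..}. f t) \<longlonglongrightarrow> 0"
proof -
  let ?M = "lebesgue_on {0::real<..}"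
  have int': "integrable ?M f" using int by (simp add: half_line_def)
  then have [measurable]: "f \<in> borel_measurable ?M" by auto
  have "(\<lambda>n. LINT t|?M. indicator {real n<..} t *\<^sub>R f t) \<longlonglongrightarrow> (LINT t|?M. 0)"
  proof (rule integral_dominated_convergence[where w = "\<lambda>t. norm (f t)"])
    have m: "{x<..} \<inter> space ?M \<in> sets ?M" for x by (auto simp: sets_restrict_space_iff)
    show "(\<lambda>t. indicator {real n<..} t *\<^sub>R f t) \<in> borel_measurable ?M" for n
      using m[of "real n"] by (intro borel_measurable_scaleR) (auto simp: borel_measurable_indicator_iff)
    show "integrable ?M (\<lambda>t. norm (f t))" using int' by simp
    show "AE t in ?M. (\<lambda>n. indicator {real n<..} t *\<^sub>R f t) \<longlonglongrightarrow> 0"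
    proof (rule AE_I2)
      fix t :: real
      have "eventually (\<lambda>n. real n > t) sequentially"
        using filterlim_real_sequentially by (simp add: filterlim_at_top_dense)
      then have "eventually (\<lambda>n. indicator {real n<..} t *\<^sub>R f t = 0) sequentially"
        by (rule eventually_mono) (auto simp: indicator_def)
      then show "(\<lambda>n. indicator {real n<..} t *\<^sub>R f t) \<longlonglongrightarrow> 0"
        by (rule tendsto_eventually)
    qed
  qed (auto simp: indicator_def)
  moreover have "(LINT t|lebesgue_on {real n<..}. f t) = (LINT t|?M. indicator {real n<..} t *\<^sub>R f t)" for n
    by (rule integral_ray) auto
  ultimately show ?thesis by simp
qed

text \<open>Continuity makes the tail integrals vanish at every point. Rays are a generator of the
  Borel sets closed under intersection, so the integral over every Borel set vanishes, and then over
  every Lebesgue set.\<close>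

lemma AE_zero_if_tail_integrals_zero:
  fixes f :: "real \<Rightarrow> 'a::{banach, second_countable_topology}"
  assumes int: "\<And>x. x > 0 \<Longrightarrow> integrable (lebesgue_on {x<..}) f"
    and zero: "AE x in half_line. (LINT t|lebesgue_on {x<..}. f t) = 0"
  shows "AE t in half_line. f t = 0"
proof -
  define T where "T x = (LINT t|lebesgue_on {x<..}. f t)" for x
  have T0: "T x = 0" if "x > 0" for x
  proof (rule ccontr)
    assume "T x \<noteq> 0"
    moreover have "isCont T x"
      using continuous_tail_integral[OF int] that unfolding T_def
      by (auto simp: continuous_on_eq_continuous_at)
    ultimately have "eventually (\<lambda>y. T y \<noteq> 0) (at x)"
      using tendsto_imp_eventually_ne[of T "T x" "at x" 0] by (simp add: isCont_def)
    then obtain d where d: "d > 0" "\<And>y. y \<noteq> x \<Longrightarrow> dist y x < d \<Longrightarrow> T y \<noteq> 0"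
      by (auto simp: eventually_at)
    have "\<exists>y. x < y \<and> y < x + d \<and> T y = 0"
      using AE_half_line_ex[OF zero, of x "x + d"] that d(1) unfolding T_def
      by simp
    then obtain y where "x < y" "y < x + d" "T y = 0" by blast
    then show False using d(2)[of y] by (auto simp: dist_real_def)
  qed
  \<comment> \<open>Cutting \<open>f\<close> off at \<open>c\<close> makes it integrable on the
    whole line.\<close>
  have AE_ray: "AE t in lebesgue. indicator {c<..} t *\<^sub>R f t = 0" if c: "c > 0" for c
  proof (rule sigma_finite_measure.density_zero)
    let ?g = "\<lambda>t. indicator {c<..} t *\<^sub>R f t"
    show "sigma_finite_measure (lebesgue :: real measure)"
    proof
      obtain C where C: "countable C" "C \<subseteq> sets lborel" "\<Union>C = (UNIV :: real set)"
        "\<forall>a\<in>C. emeasure lborel a \<noteq> \<infinity>"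
        using lborel.sigma_finite_countable by auto
      moreover have "emeasure lebesgue a = emeasure lborel a" if "a \<in> C" for a
        using C(2) that by (intro emeasure_completion[THEN trans]) auto
      ultimately show "\<exists>C. countable C \<and> C \<subseteq> sets lebesgue \<and> \<Union>C = space (lebesgue :: real measure)
          \<and> (\<forall>a\<in>C. emeasure lebesgue a \<noteq> \<infinity>)"
        by (intro exI[of _ C]) auto
    qed
    show int_g: "integrable lebesgue ?g"
      using int[OF c] by (simp add: integrable_restrict_space)
    have si: "set_integrable lebesgue A ?g" if "A \<in> sets lebesgue" for A
      unfolding set_integrable_def using that int_g by (rule integrable_mult_indicator)
    have Tl: "T x = (LINT t|lebesgue. indicator {x<..} t *\<^sub>R f t)" for x
      unfolding T_def by (subst integral_restrict_space) auto
    have leb: "A \<in> sets lebesgue" if "A \<in> sets borel" for A :: "real set"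
      using that by simp
    have borel: "sets (borel :: real measure) = sigma_sets UNIV (range greaterThan)"
      by (subst borel_Ioi) simp
    have stable: "Int_stable (range (greaterThan :: real \<Rightarrow> _))"
      unfolding Int_stable_def
    proof safe
      fix a b :: real
      have "{a<..} \<inter> {b<..} = {max a b<..}" by auto
      then show "{a<..} \<inter> {b<..} \<in> range greaterThan" by simp
    qed
    have 1: "set_lebesgue_integral lebesgue A ?g = 0" if "A \<in> sets borel" for A
      using stable subset_UNIV[of "range greaterThan", folded Pow_UNIV] that[unfolded borel]
    proof (induction rule: sigma_sets_induct_disjoint)
      case (basic A)
      then obtain x where x: "A = {x<..}" by auto
      \<comment> \<open>The ray meets the support of the cut-off function in the ray from
        \<open>max x c\<close>.\<close>
      have "set_lebesgue_integral lebesgue A ?g = T (max x c)"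
        unfolding set_lebesgue_integral_def x Tl
        by (intro Bochner_Integration.integral_cong) (auto simp: indicator_def)
      then show ?case using T0 c by simp
    next
      case empty
      then show ?case by (simp add: set_lebesgue_integral_def)
    next
      case (compl A)
      then have A: "A \<in> sets lebesgue" by (intro leb) (simp add: borel)
      have "set_lebesgue_integral lebesgue (UNIV - A) ?g
          = (LINT t|lebesgue. ?g t - indicator A t *\<^sub>R ?g t)"
        unfolding set_lebesgue_integral_def
        by (intro Bochner_Integration.integral_cong) (auto simp: indicator_def)
      also have "\<dots> = T c - set_lebesgue_integral lebesgue A ?g"
        using si[OF A] int_g unfolding Tl set_lebesgue_integral_def set_integrable_def
        by (intro Bochner_Integration.integral_diff)
      finally show ?case using T0[OF c] compl by simp
    next
      case (union A)
      then have A: "A i \<in> sets lebesgue" for i by (intro leb) (auto simp: borel)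
      have "set_lebesgue_integral lebesgue (\<Union>i. A i) ?g
          = (\<Sum>i. set_lebesgue_integral lebesgue (A i) ?g)"
        using union(1) A
        by (intro lebesgue_integral_countable_add si) (auto simp: disjoint_family_on_def)
      then show ?case using union by simp
    qed
    fix A :: "real set" assume "A \<in> sets lebesgue"
    \<comment> \<open>A Lebesgue set differs from a Borel set by part of a null set, which the
      integral ignores.\<close>
    then obtain S N N' where S: "A = S \<union> N" "N \<subseteq> N'" "N' \<in> null_sets lborel" "S \<in> sets lborel"
      by (auto elim: sets_completionE)
    have SL: "S \<in> sets lebesgue" using S(4) by simp
    have "AE t in lebesgue. t \<notin> N'"
      using S(3) AE_not_in[of N' lebesgue] null_sets_completionI by blast
    then have "AE t in lebesgue. indicator A t *\<^sub>R ?g t = indicator S t *\<^sub>R ?g t"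
      by eventually_elim (use S(1,2) in \<open>auto simp: indicator_def\<close>)
    then have "set_lebesgue_integral lebesgue A ?g = set_lebesgue_integral lebesgue S ?g"
      unfolding set_lebesgue_integral_def
      using si[OF SL] si[OF \<open>A \<in> sets lebesgue\<close>]
      by (intro integral_cong_AE) (auto simp: set_integrable_def)
    then show "set_lebesgue_integral lebesgue A ?g = 0" using 1 S(4) by simp
  qed
  \<comment> \<open>The countably many cut-offs \<open>1 / (n + 1)\<close> exhaust the
    half-line.\<close>
  have "AE t in lebesgue. \<forall>n. t > 1 / real (Suc n) \<longrightarrow> f t = 0"
    unfolding AE_all_countable
  proof
    fix n
    show "AE t in lebesgue. t > 1 / real (Suc n) \<longrightarrow> f t = 0"
      using AE_ray[of "1 / real (Suc n)"] by (auto elim!: eventually_mono)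
  qed
  then have "AE t in lebesgue. t > 0 \<longrightarrow> f t = 0"
  proof eventually_elim
    case (elim t)
    then show ?case using nat_approx_posE[of t] by (metis (no_types))
  qed
  then show ?thesis by (simp add: AE_half_line_iff)
qed

section \<open>Exponential means\<close>

text \<open>Formally the inverse of \<open>1 - d/dt\<close>. Applied to a Hankel kernel it is also
  the image of \<open>exp (- t)\<close> under the operator.\<close>

definition exp_mean :: "(real \<Rightarrow> complex) \<Rightarrow> real \<Rightarrow> complex" where
  "exp_mean g t = (LINT u|half_line. g (t + u) * of_real (exp (- u)))"

lemma measurable_exp_weight [measurable]:
  "(\<lambda>t. complex_of_real (exp (a * t + b))) \<in> borel_measurable half_line"
  by (rule measurable_half_line_continuous) (intro continuous_intros)

lemma measurable_exp_mult:
  assumes [measurable]: "g \<in> borel_measurable half_line"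
  shows "(\<lambda>y. g y * complex_of_real (exp (- y))) \<in> borel_measurable half_line"
proof -
  have [measurable]: "(\<lambda>y. complex_of_real (exp (- y))) \<in> borel_measurable half_line"
    using measurable_exp_weight[of "-1" 0] by simp
  show ?thesis by measurable
qed

lemma integrable_exp_weight:
  assumes "a < 0" "x \<ge> 0"
  shows "integrable (lebesgue_on {x<..}) (\<lambda>t::real. exp (a * t))"
    and "(LINT t|lebesgue_on {x<..}. exp (a * t)) = exp (a * x) / (- a)"
proof -
  have "((\<lambda>t. exp (- (- a) * t)) has_integral exp (- (- a) * x) / (- a)) {x..}"
    using assms by (intro has_integral_exp_minus_to_infinity) auto
  then have hi: "((\<lambda>t. exp (a * t)) has_integral exp (a * x) / (- a)) {x<..}"
    using has_integral_interior[of "{x..}" "\<lambda>t. exp (a * t)" "exp (a * x) / (- a)"]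
    by (simp add: interior_real_atLeast)
  then have "(\<lambda>t. exp (a * t)) absolutely_integrable_on {x<..}"
    by (intro nonnegative_absolutely_integrable_1) auto
  then show int: "integrable (lebesgue_on {x<..}) (\<lambda>t::real. exp (a * t))"
    by (simp add: integrable_restrict_space set_integrable_def)
  show "(LINT t|lebesgue_on {x<..}. exp (a * t)) = exp (a * x) / (- a)"
    using lebesgue_integral_eq_integral[OF int] hi by (simp add: integral_unique)
qed

lemma integrable_half_line_exp: "a < 0 \<Longrightarrow> integrable half_line (\<lambda>t::real. exp (a * t))"
  using integrable_exp_weight[of a 0] by (simp add: half_line_def)

section \<open>Closure properties of the square-integrable functions\<close>

lemma L2_measurable: "f \<in> L2 \<Longrightarrow> f \<in> borel_measurable half_line"
  by (simp add: L2_def)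

lemma L2_mult_integrable:
  assumes "f \<in> L2" "g \<in> L2"
  shows "integrable half_line (\<lambda>t. f t * g t)"
proof (rule Bochner_Integration.integrable_bound)
  show "integrable half_line (\<lambda>t. (cmod (f t))\<^sup>2 + (cmod (g t))\<^sup>2)"
    using assms by (auto simp: L2_def)
  show "(\<lambda>t. f t * g t) \<in> borel_measurable half_line"
    using assms by (auto simp: L2_def)
  show "AE t in half_line. norm (f t * g t) \<le> norm ((cmod (f t))\<^sup>2 + (cmod (g t))\<^sup>2)"
  proof (rule AE_I2)
    fix t
    have "2 * (cmod (f t) * cmod (g t)) \<le> (cmod (f t))\<^sup>2 + (cmod (g t))\<^sup>2"
      using sum_squares_bound[of "cmod (f t)" "cmod (g t)"] by simp
    moreover have "0 \<le> cmod (f t) * cmod (g t)" by simp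
    ultimately have "cmod (f t) * cmod (g t) \<le> (cmod (f t))\<^sup>2 + (cmod (g t))\<^sup>2" by linarith
    then show "norm (f t * g t) \<le> norm ((cmod (f t))\<^sup>2 + (cmod (g t))\<^sup>2)"
      by (simp add: norm_mult)
  qed
qed

lemma L2_cnj: "f \<in> L2 \<Longrightarrow> (\<lambda>t. cnj (f t)) \<in> L2"
  using measurable_compose[of f half_line borel cnj borel]
  by (simp add: L2_def borel_measurable_continuous_onI continuous_on_cnj)

lemma L2_scaleR: "f \<in> L2 \<Longrightarrow> (\<lambda>t. c *\<^sub>R f t) \<in> L2"
  by (auto simp: L2_def power_mult_distrib)

lemma L2_add:
  assumes "f \<in> L2" "g \<in> L2"
  shows "(\<lambda>t. f t + g t) \<in> L2"
proof -
  have "integrable half_line (\<lambda>t. (cmod (f t + g t))\<^sup>2)"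
  proof (rule Bochner_Integration.integrable_bound)
    show "integrable half_line (\<lambda>t. 2 * (cmod (f t))\<^sup>2 + 2 * (cmod (g t))\<^sup>2)"
      using assms by (auto simp: L2_def)
    show "(\<lambda>t. (cmod (f t + g t))\<^sup>2) \<in> borel_measurable half_line"
      using assms by (auto simp: L2_def)
    show "AE t in half_line. norm ((cmod (f t + g t))\<^sup>2) \<le> norm (2 * (cmod (f t))\<^sup>2 + 2 * (cmod (g t))\<^sup>2)"
    proof (rule AE_I2)
      fix t
      have "(cmod (f t + g t))\<^sup>2 \<le> (cmod (f t) + cmod (g t))\<^sup>2"
        by (intro power_mono norm_triangle_ineq) simp
      also have "\<dots> \<le> 2 * (cmod (f t))\<^sup>2 + 2 * (cmod (g t))\<^sup>2"
        using sum_squares_bound[of "cmod (f t)" "cmod (g t)"] by (simp add: power2_sum)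
      finally show "norm ((cmod (f t + g t))\<^sup>2) \<le> norm (2 * (cmod (f t))\<^sup>2 + 2 * (cmod (g t))\<^sup>2)"
        by simp
    qed
  qed
  then show ?thesis using assms by (auto simp: L2_def)
qed

lemma L2_zero: "(\<lambda>t. 0) \<in> L2"
  by (simp add: L2_def)

lemma L2_sum: "(\<And>i. i \<in> I \<Longrightarrow> f i \<in> L2) \<Longrightarrow> (\<lambda>t. \<Sum>i\<in>I. f i t) \<in> L2"
  by (induction I rule: infinite_finite_induct) (auto simp: L2_zero intro: L2_add)

lemma L2_exp:
  assumes "a < 0"
  shows "(\<lambda>t. of_real (exp (a * t))) \<in> L2"
proof -
  have "(exp (a * t))\<^sup>2 = exp ((2 * a) * t)" for t
    using exp_double[of "a * t"] by (simp only: mult.assoc)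
  then show ?thesis
    using measurable_exp_weight[of a 0] integrable_half_line_exp[of "2 * a"] assms by (simp add: L2_def)
qed

lemma exp_mean_integrable_iff:
  fixes g :: "real \<Rightarrow> complex"
  assumes "g \<in> borel_measurable half_line" "x \<ge> 0"
  shows "integrable half_line (\<lambda>u. g (x + u) * of_real (exp (- u)))
    \<longleftrightarrow> integrable (lebesgue_on {x<..}) (\<lambda>y. g y * of_real (exp (- y)))"
proof -
  have m: "(\<lambda>y. g y * of_real (exp (- y))) \<in> borel_measurable (lebesgue_on {x<..})"
    using assms measurable_exp_mult by (intro measurable_ray) auto
  have 1: "(\<lambda>u. g (x + u) * of_real (exp (- (x + u))))
      = (\<lambda>u. of_real (exp (- x)) * (g (x + u) * of_real (exp (- u))))"
    by (rule ext) (simp add: exp_diff exp_minus field_simps)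
  have 2: "(\<lambda>u. g (x + u) * of_real (exp (- u)))
      = (\<lambda>u. of_real (exp x) * (g (x + u) * complex_of_real (exp (- (x + u)))))"
    by (rule ext) (simp add: exp_diff exp_minus field_simps)
  have "integrable half_line (\<lambda>u. g (x + u) * of_real (exp (- u))) \<longleftrightarrow>
      integrable half_line (\<lambda>u. g (x + u) * complex_of_real (exp (- (x + u))))"
  proof
    assume "integrable half_line (\<lambda>u. g (x + u) * of_real (exp (- u)))"
    then show "integrable half_line (\<lambda>u. g (x + u) * complex_of_real (exp (- (x + u))))"
      unfolding 1 by (rule integrable_mult_right)
  next
    assume "integrable half_line (\<lambda>u. g (x + u) * complex_of_real (exp (- (x + u))))"
    then show "integrable half_line (\<lambda>u. g (x + u) * of_real (exp (- u)))"
      unfolding 2 by (rule integrable_mult_right)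
  qed
  then show ?thesis using integrable_translate_iff[OF m] by (simp only:)
qed

text \<open>The substitution \<open>y = x + u\<close>. It reduces continuity and injectivity of the
  mean to those of tail integrals.\<close>

lemma exp_mean_eq_tail:
  assumes "g \<in> borel_measurable half_line" "x \<ge> 0"
  shows "exp_mean g x = of_real (exp x) * (LINT y|lebesgue_on {x<..}. g y * of_real (exp (- y)))"
proof -
  have m: "(\<lambda>y. g y * of_real (exp (- y))) \<in> borel_measurable (lebesgue_on {x<..})"
    using assms measurable_exp_mult by (intro measurable_ray) auto
  have "of_real (exp x) * (g (x + u) * of_real (exp (- (x + u)))) = g (x + u) * of_real (exp (- u))" for u
    by (simp add: exp_diff exp_minus field_simps)
  then have "exp_mean g x = (LINT u|half_line. of_real (exp x) * (g (x + u) * of_real (exp (- (x + u)))))"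
    by (simp only: exp_mean_def)
  then show ?thesis using integral_translate[OF m] by simp
qed

lemma continuous_exp_mean:
  assumes "g \<in> borel_measurable half_line"
    and "\<And>x. x > 0 \<Longrightarrow> integrable (lebesgue_on {x<..}) (\<lambda>y. g y * of_real (exp (- y)))"
  shows "continuous_on {0<..} (exp_mean g)"
proof -
  have "continuous_on {0<..} (\<lambda>x. of_real (exp x) * (LINT y|lebesgue_on {x<..}. g y * of_real (exp (- y))))"
    by (intro continuous_intros continuous_tail_integral assms(2))
  then show ?thesis
    using exp_mean_eq_tail[OF assms(1)] by (subst continuous_on_cong[OF refl]) auto
qed

text \<open>Each exponential is an eigenfunction of the mean with eigenvalue
  \<open>1 / (1 - a)\<close>; \<open>a < 1\<close> makes the weighted integrand decay. The factors
  \<open>1 - a i\<close> cancel the eigenvalues.\<close>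

lemma exp_mean_exp_sum:
  fixes c a :: "'i \<Rightarrow> real"
  assumes "\<And>i. i \<in> I \<Longrightarrow> a i < 1" "x \<ge> 0"
  shows "exp_mean (\<lambda>t. of_real (\<Sum>i\<in>I. c i * (1 - a i) * exp (a i * t))) x = of_real (\<Sum>i\<in>I. c i * exp (a i * x))"
    and "integrable (lebesgue_on {x<..}) (\<lambda>y. complex_of_real (\<Sum>i\<in>I. c i * (1 - a i) * exp (a i * y)) * of_real (exp (- y)))"
proof -
  have eq: "(\<Sum>i\<in>I. c i * (1 - a i) * exp (a i * t)) * exp (- t)
      = (\<Sum>i\<in>I. c i * (1 - a i) * exp ((a i - 1) * t))" for t
    unfolding sum_distrib_right
    by (intro sum.cong refl) (simp add: left_diff_distrib exp_diff exp_minus divide_inverse)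
  have int: "integrable (lebesgue_on {x<..}) (\<lambda>y. (\<Sum>i\<in>I. c i * (1 - a i) * exp ((a i - 1) * y)))"
    using assms by (intro Bochner_Integration.integrable_sum integrable_mult_right integrable_exp_weight) auto
  then show "integrable (lebesgue_on {x<..}) (\<lambda>y. complex_of_real (\<Sum>i\<in>I. c i * (1 - a i) * exp (a i * y)) * of_real (exp (- y)))"
    by (simp only: of_real_mult[symmetric] eq integrable_of_real)
  have meas: "(\<lambda>t. complex_of_real (\<Sum>i\<in>I. c i * (1 - a i) * exp (a i * t))) \<in> borel_measurable half_line"
    by (intro measurable_half_line_continuous continuous_intros)
  have "(LINT y|lebesgue_on {x<..}. (\<Sum>i\<in>I. c i * (1 - a i) * exp ((a i - 1) * y)))
      = (\<Sum>i\<in>I. LINT y|lebesgue_on {x<..}. c i * (1 - a i) * exp ((a i - 1) * y))"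
    using assms by (intro Bochner_Integration.integral_sum integrable_mult_right integrable_exp_weight) auto
  also have "\<dots> = (\<Sum>i\<in>I. c i * exp ((a i - 1) * x))"
  proof (rule sum.cong)
    fix i assume "i \<in> I"
    then have "a i < 1" using assms by simp
    then show "(LINT y|lebesgue_on {x<..}. c i * (1 - a i) * exp ((a i - 1) * y)) = c i * exp ((a i - 1) * x)"
      using integrable_exp_weight(2)[of "a i - 1" x] assms(2) by simp
  qed simp
  finally have "exp_mean (\<lambda>t. of_real (\<Sum>i\<in>I. c i * (1 - a i) * exp (a i * t))) x
      = of_real (exp x * (\<Sum>i\<in>I. c i * exp ((a i - 1) * x)))"
    using exp_mean_eq_tail[OF meas assms(2)]
    by (simp only: of_real_mult[symmetric] eq integral_complex_of_real)
  also have "exp x * (\<Sum>i\<in>I. c i * exp ((a i - 1) * x)) = (\<Sum>i\<in>I. c i * exp (a i * x))"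
    unfolding sum_distrib_left
    by (intro sum.cong refl) (simp add: left_diff_distrib exp_diff)
  finally show "exp_mean (\<lambda>t. of_real (\<Sum>i\<in>I. c i * (1 - a i) * exp (a i * t))) x = of_real (\<Sum>i\<in>I. c i * exp (a i * x))" .
qed

text \<open>Inverts \<^const>\<open>exp_mean\<close>, which acts on \<open>exp (a t)\<close> as division by \<open>1 - a\<close>.\<close>

lemma exp_mean_inverse:
  fixes c a :: "'i \<Rightarrow> real"
  assumes meas: "g \<in> borel_measurable half_line"
    and int: "\<And>x. x > 0 \<Longrightarrow> integrable (lebesgue_on {x<..}) (\<lambda>y. g y * of_real (exp (- y)))"
    and a: "\<And>i. i \<in> I \<Longrightarrow> a i < 1"
    and mean: "AE x in half_line. exp_mean g x = of_real (\<Sum>i\<in>I. c i * exp (a i * x))"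
  shows "AE t in half_line. g t = of_real (\<Sum>i\<in>I. c i * (1 - a i) * exp (a i * t))"
proof -
  define w where "w t = complex_of_real (\<Sum>i\<in>I. c i * (1 - a i) * exp (a i * t))" for t
  have w: "exp_mean w x = of_real (\<Sum>i\<in>I. c i * exp (a i * x))"
    "integrable (lebesgue_on {x<..}) (\<lambda>y. w y * of_real (exp (- y)))" if "x > 0" for x
    using exp_mean_exp_sum[where a = a and I = I and x = x and c = c] a that unfolding w_def by auto
  have wm: "w \<in> borel_measurable half_line"
    unfolding w_def by (intro measurable_half_line_continuous continuous_intros)
  \<comment> \<open>Injectivity of the mean: \<open>g\<close> and \<open>w\<close> have almost
    everywhere equal means, so the weighted difference has vanishing tail integrals.\<close>
  have "AE t in half_line. g t * of_real (exp (- t)) - w t * of_real (exp (- t)) = 0"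
  proof (rule AE_zero_if_tail_integrals_zero)
    show "integrable (lebesgue_on {x<..}) (\<lambda>t. g t * of_real (exp (- t)) - w t * of_real (exp (- t)))"
      if "x > 0" for x using int w(2) that by simp
    show "AE x in half_line. (LINT t|lebesgue_on {x<..}. g t * of_real (exp (- t)) - w t * of_real (exp (- t))) = 0"
      using mean AE_space
    proof eventually_elim
      case (elim x)
      then show ?case
        using exp_mean_eq_tail[OF meas, of x] exp_mean_eq_tail[OF wm, of x] w int[of x] by simp
    qed
  qed
  then show ?thesis by eventually_elim (simp add: w_def)
qed

section \<open>The Hankel form on shifted exponentials\<close>

text \<open>Gaussian elimination by induction on the equations, with \<open>K\<close> indexing the
  unknowns: one equation is solved for an unknown that occurs in it.\<close>

lemma homogeneous_system_nontrivial:
  fixes c :: "'k \<Rightarrow> 'i \<Rightarrow> 'a::field"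
  assumes "finite I" "finite K" "card I < card K"
  shows "\<exists>a. (\<exists>k\<in>K. a k \<noteq> 0) \<and> (\<forall>i\<in>I. (\<Sum>k\<in>K. a k * c k i) = 0)"
  using assms
proof (induction I arbitrary: K c rule: finite_induct)
  case empty
  then obtain k where "k \<in> K" by fastforce
  then show ?case by (intro exI[of _ "\<lambda>_. 1"]) auto
next
  case (insert i I)
  show ?case
  proof (cases "\<forall>k\<in>K. c k i = 0")
    case True
    moreover obtain a where "\<exists>k\<in>K. a k \<noteq> 0" "\<forall>i\<in>I. (\<Sum>k\<in>K. a k * c k i) = 0"
      using insert.IH[of K c] insert.prems insert.hyps by auto
    ultimately show ?thesis by (intro exI[of _ a]) auto
  next
    case False
    then obtain l where l: "l \<in> K" "c l i \<noteq> 0" by blast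
    \<comment> \<open>The coefficients left after equation \<open>i\<close> has been used to
      eliminate the unknown \<open>l\<close>.\<close>
    define d where "d k j = c k j - c k i / c l i * c l j" for k j
    have "card I < card (K - {l})" using insert.prems insert.hyps l by simp
    then obtain a where a: "\<exists>k\<in>K - {l}. a k \<noteq> 0" "\<forall>j\<in>I. (\<Sum>k\<in>K - {l}. a k * d k j) = 0"
      using insert.IH[of "K - {l}" d] insert.prems by auto
    \<comment> \<open>The eliminated unknown receives the value that equation \<open>i\<close>
      forces.\<close>
    define b where "b = a(l := - (\<Sum>k\<in>K - {l}. a k * (c k i / c l i)))"
    have sum_b: "(\<Sum>k\<in>K. b k * c k j) = (\<Sum>k\<in>K - {l}. a k * d k j)" for j
    proof -
      have "(\<Sum>k\<in>K. b k * c k j) = b l * c l j + (\<Sum>k\<in>K - {l}. b k * c k j)"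
        using l insert.prems by (simp add: sum.remove)
      also have "(\<Sum>k\<in>K - {l}. b k * c k j) = (\<Sum>k\<in>K - {l}. a k * c k j)"
        by (intro sum.cong) (auto simp: b_def)
      also have "b l * c l j = - (\<Sum>k\<in>K - {l}. a k * (c k i / c l i * c l j))"
        by (simp add: b_def sum_distrib_right mult.assoc)
      finally show ?thesis by (simp add: d_def right_diff_distrib sum_subtractf)
    qed
    have "d k i = 0" for k using l by (simp add: d_def)
    then have "\<forall>j\<in>insert i I. (\<Sum>k\<in>K. b k * c k j) = 0"
      using a(2) by (simp add: sum_b)
    moreover have "\<exists>k\<in>K. b k \<noteq> 0" using a(1) by (auto simp: b_def)
    ultimately show ?thesis by blast
  qed
qed

section \<open>Right-shifted exponentials as test functions\<close>

definition shifted_exp :: "real \<Rightarrow> real \<Rightarrow> complex" where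
  "shifted_exp a t = (if a < t then of_real (exp (a - t)) else 0)"

lemma shifted_exp_eq:
  "shifted_exp a t = indicator {a<..} t *\<^sub>R (of_real (exp a) * of_real (exp (- t)))"
  by (simp add: shifted_exp_def exp_diff exp_minus divide_inverse)

lemma L2_shifted_exp:
  assumes "a \<ge> 0"
  shows "shifted_exp a \<in> L2"
proof -
  have e: "(\<lambda>t. complex_of_real (exp (-1 * t))) \<in> L2" by (rule L2_exp) simp
  have eq: "shifted_exp a = (\<lambda>t. of_real (exp a) * (indicator {a<..} t *\<^sub>R complex_of_real (exp (-1 * t))))"
    by (rule ext) (simp add: shifted_exp_eq)
  have "{a<..} \<inter> space half_line \<in> sets half_line"
    by (rule sets.Int[OF ray_in_sets_half_line[OF assms] sets.top])
  then have meas: "shifted_exp a \<in> borel_measurable half_line"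
    unfolding eq using L2_measurable[OF e]
    by (intro borel_measurable_times borel_measurable_const borel_measurable_scaleR)
      (simp_all add: borel_measurable_indicator_iff)
  have "integrable half_line (\<lambda>t. (cmod (shifted_exp a t))\<^sup>2)"
  proof (rule Bochner_Integration.integrable_bound)
    show "integrable half_line (\<lambda>t. (exp a)\<^sup>2 * (cmod (complex_of_real (exp (-1 * t))))\<^sup>2)"
      using e by (intro integrable_mult_right) (simp add: L2_def)
    show "(\<lambda>t. (cmod (shifted_exp a t))\<^sup>2) \<in> borel_measurable half_line"
      using meas by simp
    show "AE t in half_line. norm ((cmod (shifted_exp a t))\<^sup>2)
        \<le> norm ((exp a)\<^sup>2 * (cmod (complex_of_real (exp (-1 * t))))\<^sup>2)"
      by (rule AE_I2) (simp add: shifted_exp_eq norm_mult power_mult_distrib indicator_def)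
  qed
  with meas show ?thesis by (simp add: L2_def)
qed

text \<open>Truncation restricts the integral to the ray from \<open>a\<close>, which leaves the
  tail formula for the mean.\<close>

lemma integral_mult_shifted_exp:
  assumes g: "g \<in> borel_measurable half_line" and a: "a \<ge> 0"
  shows "(LINT t|half_line. g t * shifted_exp a t) = exp_mean g a"
proof -
  have "(LINT t|half_line. g t * shifted_exp a t)
      = (LINT t|half_line. indicator {a<..} t *\<^sub>R (of_real (exp a) * (g t * of_real (exp (- t)))))"
    by (intro Bochner_Integration.integral_cong refl) (simp add: shifted_exp_eq)
  also have "\<dots> = (LINT t|lebesgue_on {a<..}. of_real (exp a) * (g t * of_real (exp (- t))))"
    using integral_ray[of 0 a "\<lambda>t. of_real (exp a) * (g t * complex_of_real (exp (- t)))"] a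
    by (simp only: half_line_def order_refl)
  also have "\<dots> = exp_mean g a"
    using exp_mean_eq_tail[OF g a] by simp
  finally show ?thesis .
qed

lemma integrable_mult_shifted_exp:
  assumes "integrable (lebesgue_on {a<..}) (\<lambda>t. g t * of_real (exp (- t)))" "a \<ge> 0"
  shows "integrable half_line (\<lambda>t. g t * shifted_exp a t)"
proof -
  have "integrable (lebesgue_on {a<..}) (\<lambda>t. of_real (exp a) * (g t * complex_of_real (exp (- t))))"
    using assms(1) by (rule integrable_mult_right)
  then have "integrable half_line (\<lambda>t. indicator {a<..} t *\<^sub>R (of_real (exp a) * (g t * of_real (exp (- t)))))"
    using integrable_ray_iff[of 0 a "\<lambda>t. of_real (exp a) * (g t * complex_of_real (exp (- t)))"] assms(2)
    by (simp only: half_line_def order_refl)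
  then show ?thesis by (simp add: shifted_exp_eq mult.left_commute)
qed

section \<open>The Hankel operator and its form on combinations of test functions\<close>

locale hankel =
  fixes h :: "real \<Rightarrow> complex"
  assumes kernel: "hankel_kernel h"
begin

abbreviation F where "F \<equiv> exp_mean h"
abbreviation \<beta> where "\<beta> \<equiv> exp_mean F"

lemma h_measurable: "h \<in> borel_measurable half_line"
  using kernel by (simp add: hankel_kernel_def)

lemma L2_hankel_op: "f \<in> L2 \<Longrightarrow> hankel_op h f \<in> L2"
  using kernel by (simp add: hankel_kernel_def L2_bounded_def)

text \<open>\<open>F\<close> is the image of \<open>exp (- t)\<close> under the operator.\<close>

lemma F_L2: "F \<in> L2"
proof -
  have "F = hankel_op h (\<lambda>t. of_real (exp (-1 * t)))"
    by (simp add: fun_eq_iff exp_mean_def hankel_op_def)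
  then show ?thesis using L2_hankel_op L2_exp[of "-1"] by simp
qed

text \<open>The kernel condition gives convergence only for almost every \<open>t\<close>; some such
  \<open>t\<close> lies below \<open>x\<close>, and its ray contains the one from
  \<open>x\<close>.\<close>

lemma h_integrable:
  assumes "x > 0"
  shows "integrable (lebesgue_on {x<..}) (\<lambda>y. h y * of_real (exp (- y)))"
proof -
  have "AE t in half_line. integrable half_line (\<lambda>s. h (t + s) * of_real (exp (-1 * s)))"
    using kernel L2_exp[of "-1"] by (simp add: hankel_kernel_def)
  then obtain t where t: "0 < t" "t < x" "integrable half_line (\<lambda>s. h (t + s) * of_real (exp (-1 * s)))"
    using AE_half_line_ex[of _ 0 x] assms by blast
  then have "integrable (lebesgue_on {t<..}) (\<lambda>y. h y * of_real (exp (- y)))"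
    using exp_mean_integrable_iff[OF h_measurable, of t] by simp
  then show ?thesis using integrable_ray_mono[of t _ x] t by simp
qed

lemma F_integrable:
  assumes "x \<ge> 0"
  shows "integrable (lebesgue_on {x<..}) (\<lambda>y. F y * of_real (exp (- y)))"
proof -
  have "integrable half_line (\<lambda>y. F y * of_real (exp (-1 * y)))"
    by (intro L2_mult_integrable F_L2 L2_exp) simp
  then show ?thesis using integrable_ray_mono[of 0 _ x] assms by (simp add: half_line_def)
qed

lemma F_translate_integrable:
  assumes "x \<ge> 0"
  shows "integrable half_line (\<lambda>u. F (x + u) * of_real (exp (- u)))"
  using exp_mean_integrable_iff[OF L2_measurable[OF F_L2] assms] F_integrable[OF assms] by simp

lemma integrable_hankel_shifted_exp:
  assumes "t > 0" "a \<ge> 0"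
  shows "integrable half_line (\<lambda>s. h (t + s) * shifted_exp a s)"
proof (rule integrable_mult_shifted_exp[OF _ assms(2)])
  have m: "(\<lambda>s. h (t + s)) \<in> borel_measurable half_line"
    using measurable_translate[OF h_measurable] assms by simp
  have "integrable half_line (\<lambda>u. h (t + a + u) * of_real (exp (- u)))"
    using exp_mean_integrable_iff[OF h_measurable, of "t + a"] h_integrable assms by simp
  then show "integrable (lebesgue_on {a<..}) (\<lambda>s. h (t + s) * of_real (exp (- s)))"
    using exp_mean_integrable_iff[OF m assms(2)] by (simp add: add.assoc)
qed

text \<open>Substituting \<open>s = a + u\<close> moves the shift onto the kernel, whose argument
  \<open>t + a + u\<close> involves only the sum \<open>t + a\<close>.\<close>

lemma hankel_op_shifted_exp:
  assumes "t > 0" "a \<ge> 0"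
  shows "hankel_op h (shifted_exp a) t = F (t + a)"
proof -
  have "(\<lambda>s. h (t + s)) \<in> borel_measurable half_line"
    using measurable_translate[OF h_measurable] assms by simp
  then show ?thesis
    using assms integral_mult_shifted_exp[of "\<lambda>s. h (t + s)" a]
    by (simp add: hankel_op_def exp_mean_def add.assoc)
qed

text \<open>Weights are encoded as a polynomial so that the bilinear form becomes polynomial
  multiplication in \<open>comb_form\<close>.\<close>

definition comb :: "real poly \<Rightarrow> real \<Rightarrow> real \<Rightarrow> complex" where
  "comb p x t = poly_shift p (\<lambda>a. shifted_exp a t) x"

lemma comb_L2: "x \<ge> 0 \<Longrightarrow> comb p x \<in> L2"
  unfolding comb_def[abs_def] poly_shift_def by (intro L2_sum L2_scaleR L2_shifted_exp) simp

text \<open>Real values turn the Hermitian form on these vectors into a bilinear one.\<close>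

lemma cnj_comb: "cnj (comb p x t) = comb p x t"
  by (simp add: comb_def poly_shift_def shifted_exp_eq)

lemma integrable_hankel_comb:
  assumes "t > 0" "x \<ge> 0"
  shows "integrable half_line (\<lambda>s. h (t + s) * comb p x s)"
  unfolding comb_def poly_shift_def sum_distrib_left mult_scaleR_right
  using assms by (intro Bochner_Integration.integrable_sum integrable_scaleR_right integrable_hankel_shifted_exp) auto

lemma hankel_op_comb:
  assumes "t > 0" "x \<ge> 0"
  shows "hankel_op h (comb p x) t = poly_shift p F (x + t)"
proof -
  have "hankel_op h (comb p x) t
      = (LINT s|half_line. (\<Sum>i\<le>degree p. coeff p i *\<^sub>R (h (t + s) * shifted_exp (x + real i) s)))"
    by (simp add: hankel_op_def comb_def poly_shift_def sum_distrib_left)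
  also have "\<dots> = (\<Sum>i\<le>degree p. LINT s|half_line. coeff p i *\<^sub>R (h (t + s) * shifted_exp (x + real i) s))"
    using assms by (intro Bochner_Integration.integral_sum integrable_scaleR_right integrable_hankel_shifted_exp) auto
  also have "\<dots> = (\<Sum>i\<le>degree p. coeff p i *\<^sub>R hankel_op h (shifted_exp (x + real i)) t)"
    by (simp add: hankel_op_def)
  also have "\<dots> = poly_shift p F (x + t)"
    using assms by (simp add: hankel_op_shifted_exp poly_shift_def ac_simps)
  finally show ?thesis .
qed

lemma hankel_op_add_comb:
  assumes "t > 0" "x \<ge> 0" "y \<ge> 0"
  shows "hankel_op h (\<lambda>s. comb p x s + comb q y s) t = hankel_op h (comb p x) t + hankel_op h (comb q y) t"
  using assms unfolding hankel_op_def distrib_left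
  by (intro Bochner_Integration.integral_add integrable_hankel_comb)

lemma poly_shift_F_measurable:
  assumes "x \<ge> 0"
  shows "(\<lambda>t. poly_shift p F (x + t)) \<in> borel_measurable half_line"
  unfolding poly_shift_def
proof (intro borel_measurable_sum borel_measurable_scaleR borel_measurable_const)
  fix i
  show "(\<lambda>t. F (x + t + real i)) \<in> borel_measurable half_line"
    using measurable_translate[OF L2_measurable[OF F_L2], of "x + real i"] assms
    by (simp add: ac_simps)
qed

lemma exp_mean_poly_shift_F:
  assumes "x \<ge> 0" "b \<ge> 0"
  shows "exp_mean (\<lambda>t. poly_shift p F (x + t)) b = poly_shift p \<beta> (x + b)"
proof -
  have "exp_mean (\<lambda>t. poly_shift p F (x + t)) b
      = (LINT u|half_line. (\<Sum>i\<le>degree p. coeff p i *\<^sub>R (F ((x + b + real i) + u) * of_real (exp (- u)))))"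
    unfolding exp_mean_def[of "\<lambda>t. poly_shift p F (x + t)"]
    unfolding poly_shift_def sum_distrib_right mult_scaleR_left
    by (simp only: ac_simps)
  also have "\<dots> = (\<Sum>i\<le>degree p. LINT u|half_line. coeff p i *\<^sub>R (F ((x + b + real i) + u) * of_real (exp (- u))))"
    using assms by (intro Bochner_Integration.integral_sum integrable_scaleR_right F_translate_integrable) auto
  also have "\<dots> = poly_shift p \<beta> (x + b)"
    by (simp add: poly_shift_def exp_mean_def[of F])
  finally show ?thesis .
qed

lemma integrable_comb_form:
  assumes "x \<ge> 0" "y \<ge> 0"
  shows "integrable half_line (\<lambda>t. hankel_op h (comb p x) t * comb q y t)"
  using assms by (intro L2_mult_integrable L2_hankel_op comb_L2)

text \<open>The form on shifts by \<open>a\<close> and \<open>b\<close> is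
  \<open>\<beta>(a + b)\<close>. Hence the weights of \<open>p\<close> and \<open>q\<close> act
  through successive unit shifts, that is through the product polynomial.\<close>

lemma comb_form:
  assumes "x \<ge> 0" "y \<ge> 0"
  shows "(LINT t|half_line. hankel_op h (comb p x) t * comb q y t) = poly_shift (p * q) \<beta> (x + y)"
proof -
  let ?G = "\<lambda>t. poly_shift p F (x + t)"
  have "(LINT t|half_line. hankel_op h (comb p x) t * comb q y t)
      = (LINT t|half_line. (\<Sum>j\<le>degree q. coeff q j *\<^sub>R (hankel_op h (comb p x) t * shifted_exp (y + real j) t)))"
    by (simp add: comb_def[of q] poly_shift_def[of q] sum_distrib_left)
  also have "\<dots> = (\<Sum>j\<le>degree q. LINT t|half_line. coeff q j *\<^sub>R (hankel_op h (comb p x) t * shifted_exp (y + real j) t))"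
    using assms
    by (intro Bochner_Integration.integral_sum integrable_scaleR_right L2_mult_integrable
        L2_hankel_op comb_L2 L2_shifted_exp) auto
  also have "\<dots> = (\<Sum>j\<le>degree q. coeff q j *\<^sub>R (LINT t|half_line. ?G t * shifted_exp (y + real j) t))"
  proof (intro sum.cong refl)
    fix j
    have "(LINT t|half_line. hankel_op h (comb p x) t * shifted_exp (y + real j) t)
        = (LINT t|half_line. ?G t * shifted_exp (y + real j) t)"
      using assms by (intro Bochner_Integration.integral_cong refl) (simp add: hankel_op_comb)
    then show "(LINT t|half_line. coeff q j *\<^sub>R (hankel_op h (comb p x) t * shifted_exp (y + real j) t))
        = coeff q j *\<^sub>R (LINT t|half_line. ?G t * shifted_exp (y + real j) t)"
      by simp
  qed
  also have "\<dots> = (\<Sum>j\<le>degree q. coeff q j *\<^sub>R poly_shift p \<beta> (x + (y + real j)))"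
    using assms by (intro sum.cong refl)
      (simp add: integral_mult_shifted_exp poly_shift_F_measurable exp_mean_poly_shift_F)
  also have "\<dots> = poly_shift (q * p) \<beta> (x + y)"
    by (simp add: poly_shift_mult poly_shift_def[of q] add.assoc)
  finally show ?thesis by (simp add: mult.commute)
qed

section \<open>Transfer of positivity and finite rank to \<beta>\<close>

lemma Re_poly_shift: "Re (poly_shift p b x) = poly_shift p (\<lambda>x. Re (b x)) x"
  by (simp add: poly_shift_def)

lemma continuous_\<beta>: "continuous_on {0<..} \<beta>"
  by (rule continuous_exp_mean[OF L2_measurable[OF F_L2] F_integrable]) simp

text \<open>The value at \<open>x\<close> is the quadratic form at the exponential shifted by
  \<open>x / 2\<close>; positivity also makes it real.\<close>

lemma \<beta>_nonneg:
  assumes "L2_positive (hankel_op h)" "x \<ge> 0"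
  shows "\<beta> x \<in> \<real>\<^sub>\<ge>\<^sub>0"
proof -
  have "L2_inner (hankel_op h (comb 1 (x / 2))) (comb 1 (x / 2)) \<in> \<real>\<^sub>\<ge>\<^sub>0"
    using assms comb_L2 by (auto simp: L2_positive_def)
  then show ?thesis
    using comb_form[of "x / 2" "x / 2" 1 1] assms by (simp add: L2_inner_def cnj_comb)
qed

text \<open>Positivity is tested on the sum of two combinations; the two cross terms agree because
  \<beta> sees only the sum of the shifts.\<close>

lemma \<beta>_exp_convex:
  assumes "L2_positive (hankel_op h)"
  shows "exp_convex (\<lambda>x. Re (\<beta> x))"
proof
  show "continuous_on {0<..} (\<lambda>x. Re (\<beta> x))"
    by (intro continuous_intros continuous_\<beta>)
  fix p q :: "real poly" and x y :: real
  assume xy: "x \<ge> 0" "y \<ge> 0"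
  define u w where "u = comb p x" and "w = comb q y"
  let ?H = "hankel_op h"
  have "(\<lambda>t. u t + w t) \<in> L2" using xy by (auto simp: u_def w_def intro: L2_add comb_L2)
  then have "L2_inner (?H (\<lambda>t. u t + w t)) (\<lambda>t. u t + w t) \<in> \<real>\<^sub>\<ge>\<^sub>0"
    using assms by (simp add: L2_positive_def)
  also have "L2_inner (?H (\<lambda>t. u t + w t)) (\<lambda>t. u t + w t)
      = (LINT t|half_line. (?H u t * u t + ?H u t * w t) + (?H w t * u t + ?H w t * w t))"
    unfolding L2_inner_def using xy
    by (intro Bochner_Integration.integral_cong refl)
      (simp add: u_def w_def hankel_op_add_comb cnj_comb algebra_simps)
  also have "\<dots> = poly_shift (p * p) \<beta> (x + x) + poly_shift (p * q) \<beta> (x + y)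
      + (poly_shift (q * p) \<beta> (y + x) + poly_shift (q * q) \<beta> (y + y))"
    unfolding u_def w_def using xy
    by (simp add: comb_form integrable_comb_form)
  finally show "0 \<le> poly_shift (p * p) (\<lambda>x. Re (\<beta> x)) (2 * x)
      + 2 * poly_shift (p * q) (\<lambda>x. Re (\<beta> x)) (x + y)
      + poly_shift (q * q) (\<lambda>x. Re (\<beta> x)) (2 * y)"
    by (simp add: complex_nonneg_Reals_iff Re_poly_shift mult.commute[of q p] add.commute[of y x])
qed

text \<open>The images of the exponentials shifted by \<open>0, ..., n\<close> are
  \<open>n + 1\<close> elements of a span of \<open>n\<close> functions, and they are the translates
  of \<open>F\<close>.\<close>

lemma finite_rank_relation:
  assumes "L2_finite_rank (hankel_op h)"
  shows "\<exists>(n::nat) a. (\<exists>k\<le>n. a k \<noteq> 0) \<and> (AE t in half_line. (\<Sum>k\<le>n. a k * F (t + real k)) = 0)"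
proof -
  obtain n :: nat and g where g: "\<And>f. f \<in> L2 \<Longrightarrow> \<exists>c :: nat \<Rightarrow> complex.
      AE t in half_line. hankel_op h f t = (\<Sum>i<n. c i * g i t)"
    using assms unfolding L2_finite_rank_def by blast
  have "\<exists>c. \<forall>k :: nat. AE t in half_line. hankel_op h (shifted_exp (real k)) t = (\<Sum>i<n. c k i * g i t)"
    using g L2_shifted_exp by (intro choice) auto
  then obtain c where c: "\<And>k :: nat. AE t in half_line. hankel_op h (shifted_exp (real k)) t = (\<Sum>i<n. c k i * g i t)"
    by blast
  \<comment> \<open>There are \<open>n + 1\<close> unknowns, indexed from 0 to \<open>n\<close>,
    against \<open>n\<close> equations.\<close>
  obtain a where a: "\<exists>k\<in>{..n}. a k \<noteq> 0" "\<forall>i\<in>{..<n}. (\<Sum>k\<in>{..n}. a k * c k i) = 0"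
    using homogeneous_system_nontrivial[of "{..<n}" "{..n}" c] by auto
  have "AE t in half_line. \<forall>k. hankel_op h (shifted_exp (real k)) t = (\<Sum>i<n. c k i * g i t)"
    unfolding AE_all_countable using c by blast
  then have "AE t in half_line. (\<Sum>k\<le>n. a k * F (t + real k)) = 0"
    using AE_space
  proof eventually_elim
    case (elim t)
    have "(\<Sum>k\<le>n. a k * F (t + real k)) = (\<Sum>k\<le>n. a k * hankel_op h (shifted_exp (real k)) t)"
      using elim(2) by (simp add: hankel_op_shifted_exp)
    also have "\<dots> = (\<Sum>k\<le>n. \<Sum>i<n. a k * c k i * g i t)"
      using elim(1) by (simp add: sum_distrib_left mult.assoc)
    also have "\<dots> = (\<Sum>i<n. (\<Sum>k\<le>n. a k * c k i) * g i t)"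
      by (subst sum.swap) (simp add: sum_distrib_right)
    also have "\<dots> = 0" using a(2) by simp
    finally show ?case .
  qed
  then show ?thesis using a(1) by blast
qed

text \<open>Averaging the relation for \<open>F\<close> gives one for \<beta> at every point. As
  \<beta> is real, the real and imaginary parts of the complex coefficients each give a real
  annihilating polynomial, and one of these is non-zero.\<close>

lemma finite_rank_annihilator:
  assumes "L2_finite_rank (hankel_op h)" "L2_positive (hankel_op h)"
  shows "\<exists>p\<noteq>0. \<forall>x>0. poly_shift p (\<lambda>x. Re (\<beta> x)) x = 0"
proof -
  obtain n a where a: "\<exists>k\<le>n. a k \<noteq> 0" "AE t in half_line. (\<Sum>k\<le>n. a k * F (t + real k)) = 0"
    using finite_rank_relation[OF assms(1)] by blast
  have rel: "(\<Sum>k\<le>n. a k * \<beta> (x + real k)) = 0" if "x > 0" for x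
  proof -
    have "(\<Sum>k\<le>n. a k * \<beta> (x + real k))
        = (\<Sum>k\<le>n. LINT u|half_line. a k * (F ((x + real k) + u) * of_real (exp (- u))))"
      by (simp add: exp_mean_def[of F])
    also have "\<dots> = (LINT u|half_line. (\<Sum>k\<le>n. a k * (F ((x + real k) + u) * of_real (exp (- u)))))"
      using that
      by (intro Bochner_Integration.integral_sum[symmetric] integrable_mult_right F_translate_integrable) simp
    also have "\<dots> = 0"
    proof (rule integral_eq_zero_AE)
      have "AE u in half_line. (\<Sum>k\<le>n. a k * F (x + u + real k)) = 0"
        using AE_translate[OF a(2)] that by simp
      then show "AE u in half_line. (\<Sum>k\<le>n. a k * (F ((x + real k) + u) * of_real (exp (- u)))) = 0"
      proof eventually_elim
        case (elim u)
        have "(\<Sum>k\<le>n. a k * (F ((x + real k) + u) * of_real (exp (- u))))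
            = (\<Sum>k\<le>n. a k * F (x + u + real k)) * of_real (exp (- u))"
          by (simp add: sum_distrib_right mult.assoc add.assoc add.commute[of u])
        then show ?case using elim by simp
      qed
    qed
    finally show ?thesis .
  qed
  have real: "\<beta> (x + real k) = of_real (Re (\<beta> (x + real k)))" if "x > 0" for x k
    using \<beta>_nonneg[OF assms(2), of "x + real k"] that
    by (simp add: complex_nonneg_Reals_iff complex_eq_iff)
  define P where "P f = (\<Sum>k\<le>n. monom (f (a k)) k)" for f :: "complex \<Rightarrow> real"
  have P: "poly_shift (P f) (\<lambda>x. Re (\<beta> x)) x = (\<Sum>k\<le>n. f (a k) * Re (\<beta> (x + real k)))" for f x
  proof -
    have "degree (P f) \<le> n"
      unfolding P_def by (intro degree_sum_le) (auto intro: order.trans[OF degree_monom_le])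
    moreover have "coeff (P f) k = f (a k)" if "k \<le> n" for k
      using that by (simp add: P_def coeff_sum)
    ultimately show ?thesis by (simp add: poly_shift_eq_sum)
  qed
  have zero: "poly_shift (P Re) (\<lambda>x. Re (\<beta> x)) x = 0" "poly_shift (P Im) (\<lambda>x. Re (\<beta> x)) x = 0"
    if "x > 0" for x
  proof -
    have "(\<Sum>k\<le>n. a k * of_real (Re (\<beta> (x + real k)))) = 0"
      using rel[OF that] real[OF that] by simp
    then show "poly_shift (P Re) (\<lambda>x. Re (\<beta> x)) x = 0" "poly_shift (P Im) (\<lambda>x. Re (\<beta> x)) x = 0"
      by (simp_all add: P complex_eq_iff)
  qed
  obtain k where k: "k \<le> n" "a k \<noteq> 0" using a(1) by blast
  then have "coeff (P Re) k \<noteq> 0 \<or> coeff (P Im) k \<noteq> 0"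
    by (auto simp: P_def coeff_sum complex_eq_iff)
  then have "P Re \<noteq> 0 \<or> P Im \<noteq> 0" by auto
  then show ?thesis using zero by blast
qed

text \<open>Along the integers \<beta> pairs ever smaller tails of the square-integrable
  \<open>F\<close> with a fixed exponential, so it cannot stay above \<open>c\<close>.\<close>

lemma \<beta>_not_bounded_below:
  assumes c: "c > 0" and lower: "\<And>x. x > 0 \<Longrightarrow> c \<le> Re (\<beta> x)"
  shows False
proof -
  define T where "T n = (LINT t|lebesgue_on {real n<..}. (cmod (F t))\<^sup>2)" for n
  have FI: "integrable half_line (\<lambda>t. (cmod (F t))\<^sup>2)" using F_L2 by (simp add: L2_def)
  have "T \<longlonglongrightarrow> 0" unfolding T_def by (rule tail_integral_tendsto_0[OF FI])
  moreover have "c\<^sup>2 > 0" using c by simp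
  \<comment> \<open>With this threshold the final bound is \<open>c / 2 + c / 4 < c\<close>.\<close>
  ultimately have "eventually (\<lambda>n. T n < c\<^sup>2) sequentially" by (rule order_tendstoD(2))
  then obtain n where n: "T n < c\<^sup>2" "n > 0"
    using eventually_happens[OF eventually_conj[OF _ eventually_gt_at_top[of 0]]] by auto
  have m: "(\<lambda>t. (cmod (F t))\<^sup>2) \<in> borel_measurable (lebesgue_on {real n<..})"
    using FI by (intro measurable_ray) auto
  have T_eq: "T n = (LINT u|half_line. (cmod (F (real n + u)))\<^sup>2)"
    using integral_translate[OF m] by (simp add: T_def)
  have int1: "integrable half_line (\<lambda>u. (cmod (F (real n + u)))\<^sup>2)"
    using integrable_translate_iff[OF m] integrable_ray_mono[of 0 _ "real n"] FI by (simp add: half_line_def)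
  have int2: "integrable half_line (\<lambda>u::real. exp (-2 * u))"
    by (rule integrable_half_line_exp) simp
  have val2: "(LINT u|half_line. exp (-2 * u)) = (1 / 2 :: real)"
    using integrable_exp_weight(2)[of "-2" 0] by (simp add: half_line_def)
  have "c \<le> Re (\<beta> (real n))" using lower n(2) by simp
  also have "\<dots> \<le> cmod (\<beta> (real n))" by (rule complex_Re_le_cmod)
  also have "\<dots> \<le> (LINT u|half_line. (cmod (F (real n + u)))\<^sup>2 / (2 * c) + c / 2 * exp (-2 * u))"
    unfolding exp_mean_def[of F]
  proof (rule Bochner_Integration.integral_norm_bound_integral)
    show "integrable half_line (\<lambda>u. F (real n + u) * of_real (exp (- u)))"
      by (rule F_translate_integrable) simp
    show "integrable half_line (\<lambda>u. (cmod (F (real n + u)))\<^sup>2 / (2 * c) + c / 2 * exp (-2 * u))"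
      using int1 int2 by (intro Bochner_Integration.integrable_add integrable_divide integrable_mult_right) auto
    fix u :: real
    let ?r = "cmod (F (real n + u))"
    \<comment> \<open>Weighted arithmetic-geometric mean inequality; the weight \<open>c\<close>
      balances the tail of \<open>F\<close> against the exponential.\<close>
    have "0 \<le> (?r - c * exp (- u))\<^sup>2 / (2 * c)" using c by simp
    also have "\<dots> = ?r\<^sup>2 / (2 * c) + c / 2 * (exp (- u))\<^sup>2 - ?r * exp (- u)"
      using c by (simp add: power2_eq_square field_simps)
    also have "(exp (- u))\<^sup>2 = exp (-2 * u)" using exp_double[of "- u"] by simp
    finally show "norm (F (real n + u) * of_real (exp (- u))) \<le> ?r\<^sup>2 / (2 * c) + c / 2 * exp (-2 * u)"
      by (simp add: norm_mult)
  qed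
  also have "\<dots> = T n / (2 * c) + c / 4"
    using int1 int2 val2 by (simp add: T_eq)
  also have "\<dots> < c\<^sup>2 / (2 * c) + c / 4"
    using n(1) c by (simp add: divide_strict_right_mono)
  also have "\<dots> < c" using c by (simp add: power2_eq_square)
  finally show False .
qed

text \<open>The exponential sum for \<beta> is carried back to \<open>F\<close> and then to
  \<open>h\<close> by inverting the mean twice.\<close>

theorem positive_kernel:
  assumes "L2_finite_rank (hankel_op h)" "L2_positive (hankel_op h)"
  shows "\<exists>Z c. finite Z \<and> (\<forall>l\<in>Z. l < 0 \<and> c l > 0) \<and>
    (AE t in half_line. h t = of_real (\<Sum>l\<in>Z. c l * exp (l * t)))"
proof -
  interpret exp_convex "\<lambda>x. Re (\<beta> x)" by (rule \<beta>_exp_convex[OF assms(2)])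
  obtain p where "p \<noteq> 0" "annihilates p"
    using finite_rank_annihilator[OF assms] by (auto simp: annihilates_def)
  then obtain Z d where "finite Z \<and> Z \<subseteq> {0<..} \<and> (\<forall>l\<in>Z. d l \<ge> 0) \<and>
      (\<forall>x>0. Re (\<beta> x) = (\<Sum>l\<in>Z. d l * l powr x))"
    by (elim finite_exponential_sum[THEN exE] exE)
  then have Z: "finite Z" "Z \<subseteq> {0<..}" "\<forall>l\<in>Z. d l \<ge> 0"
    and sum: "\<And>x. x > 0 \<Longrightarrow> Re (\<beta> x) = (\<Sum>l\<in>Z. d l * l powr x)"
    by auto
  \<comment> \<open>Logarithms turn bases into exponents; dropping zero weights makes the remaining
    ones strictly positive.\<close>
  define L where "L = ln ` {l\<in>Z. d l > 0}"
  define c where "c l = d (exp l)" for l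
  have L: "finite L" "\<And>l. l \<in> L \<Longrightarrow> c l > 0"
    using Z by (auto simp: L_def c_def)
  have sumL: "Re (\<beta> x) = (\<Sum>l\<in>L. c l * exp (l * x))" if "x > 0" for x
  proof -
    have "(\<Sum>l\<in>L. c l * exp (l * x)) = (\<Sum>l\<in>{l\<in>Z. d l > 0}. c (ln l) * exp (ln l * x))"
    proof -
      have "inj_on ln {0::real<..}" by (auto intro!: inj_onI)
      then have "inj_on ln {l\<in>Z. d l > 0}" by (rule inj_on_subset) (use Z(2) in auto)
      then show ?thesis unfolding L_def by (subst sum.reindex) simp_all
    qed
    also have "\<dots> = (\<Sum>l\<in>{l\<in>Z. d l > 0}. d l * l powr x)"
      using Z(2) by (intro sum.cong refl) (auto simp: c_def powr_def mult.commute)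
    also have "\<dots> = (\<Sum>l\<in>Z. d l * l powr x)"
      using Z by (intro sum.mono_neutral_left) (auto simp: order.order_iff_strict)
    finally show ?thesis using sum[OF that] by simp
  qed
  have neg: "l < 0" if l: "l \<in> L" for l
  proof (rule ccontr)
    assume "\<not> l < 0"
    show False
    \<comment> \<open>An exponent \<open>l \<ge> 0\<close> would keep its own term, and hence the
      whole sum, at least \<open>c l\<close>.\<close>
    proof (rule \<beta>_not_bounded_below[of "c l"])
      fix x :: real assume x: "x > 0"
      have "c l * 1 \<le> c l * exp (l * x)"
        using \<open>\<not> l < 0\<close> x L(2)[OF l] by (intro mult_left_mono) auto
      also have "\<dots> \<le> (\<Sum>l\<in>L. c l * exp (l * x))"
        using L l by (intro member_le_sum) (auto intro: mult_nonneg_nonneg less_imp_le)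
      finally show "c l \<le> Re (\<beta> x)" using sumL[OF x] by simp
    qed (use L(2) l in auto)
  qed
  have one: "l < 1" if "l \<in> L" for l using neg[OF that] by simp
  have "AE x in half_line. \<beta> x = of_real (\<Sum>l\<in>L. c l * exp (l * x))"
  proof (rule AE_I2)
    fix x assume "x \<in> space half_line"
    then have "x > 0" by simp
    then show "\<beta> x = of_real (\<Sum>l\<in>L. c l * exp (l * x))"
      using \<beta>_nonneg[OF assms(2), of x] sumL[of x]
      by (simp add: complex_nonneg_Reals_iff complex_eq_iff)
  qed
  \<comment> \<open>Each of the two inversions multiplies a weight by \<open>1 - l > 0\<close>,
    which preserves its sign.\<close>
  then have "AE x in half_line. F x = of_real (\<Sum>l\<in>L. c l * (1 - l) * exp (l * x))"
    using F_integrable one by (intro exp_mean_inverse[OF L2_measurable[OF F_L2]]) auto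
  then have "AE x in half_line. h x = of_real (\<Sum>l\<in>L. c l * (1 - l) * (1 - l) * exp (l * x))"
    using h_integrable one by (intro exp_mean_inverse[OF h_measurable]) auto
  moreover have "c l * (1 - l) * (1 - l) > 0" if "l \<in> L" for l
    using L(2)[OF that] one[OF that] by simp
  ultimately show ?thesis
    using L(1) neg by (intro exI[of _ L] exI[of _ "\<lambda>l. c l * (1 - l) * (1 - l)"] conjI ballI)
qed

end


section \<open>Characterisation of positive and negative kernels\<close>

lemma finite_exp_sum_indexed:
  fixes c :: "real \<Rightarrow> real"
  assumes "finite Z" "\<forall>l\<in>Z. l < 0 \<and> c l > 0"
  obtains M :: nat and p \<alpha> :: "nat \<Rightarrow> real"
  where "\<forall>m\<in>{1..M}. \<alpha> m > 0 \<and> p m > 0"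
    and "\<And>t. (\<Sum>l\<in>Z. c l * exp (l * t)) = (\<Sum>m=1..M. p m * exp (- \<alpha> m * t))"
proof -
  obtain b where b: "bij_betw b {1..card Z} Z"
    using ex_bij_betw_nat_finite_1[OF assms(1)] by blast
  show ?thesis
  proof (rule that[of "card Z" "\<lambda>m. - b m" "\<lambda>m. c (b m)"])
    show "\<forall>m\<in>{1..card Z}. - b m > 0 \<and> c (b m) > 0"
      using bij_betwE[OF b] assms(2) by auto
    show "(\<Sum>l\<in>Z. c l * exp (l * t)) = (\<Sum>m=1..card Z. c (b m) * exp (- (- b m) * t))" for t
      using sum.reindex_bij_betw[OF b, of "\<lambda>l. c l * exp (l * t)"] by simp
  qed
qed

text \<open>Since \<open>exp\<close> turns \<open>t + s\<close> into a product, each exponential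
  contributes an operator of rank at most one, whose form is its weight times a squared
  modulus.\<close>

lemma hankel_form_exp_sum:
  fixes p \<alpha> :: "'i \<Rightarrow> real"
  assumes h: "h \<in> borel_measurable half_line"
    and sum: "AE t in half_line. h t = of_real (\<Sum>m\<in>I. p m * exp (- \<alpha> m * t))"
    and pos: "\<And>m. m \<in> I \<Longrightarrow> \<alpha> m > 0"
    and f: "f \<in> L2"
  shows "L2_inner (hankel_op h f) f
    = of_real (\<Sum>m\<in>I. p m * (cmod (LINT s|half_line. of_real (exp (- \<alpha> m * s)) * f s))\<^sup>2)"
proof -
  define e where "e m t = complex_of_real (exp (- \<alpha> m * t))" for m t
  define \<phi> where "\<phi> m = (LINT s|half_line. e m s * f s)" for m
  have e: "e m \<in> L2" if "m \<in> I" for m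
    using L2_exp[of "- \<alpha> m"] pos[OF that] by (simp add: e_def[abs_def])
  have int: "integrable half_line (\<lambda>s. e m s * f s)" "integrable half_line (\<lambda>s. e m s * cnj (f s))"
    if "m \<in> I" for m
    using e[OF that] f by (auto intro: L2_mult_integrable L2_cnj)
  have e_add: "e m (t + s) = e m t * e m s" for m t s
    by (simp add: e_def distrib_left mult_exp_exp flip: of_real_mult)
  have cnj: "(LINT t|half_line. e m t * cnj (f t)) = cnj (\<phi> m)" for m
  proof -
    have "(LINT t|half_line. e m t * cnj (f t)) = (LINT t|half_line. cnj (e m t * f t))"
      by (simp add: e_def)
    then show ?thesis by (simp only: Bochner_Integration.integral_cnj \<phi>_def)
  qed
  have H: "hankel_op h f t = (\<Sum>m\<in>I. of_real (p m) * \<phi> m * e m t)" if t: "t > 0" for t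
  proof -
    have "hankel_op h f t = (LINT s|half_line. (\<Sum>m\<in>I. of_real (p m) * e m t * (e m s * f s)))"
      unfolding hankel_op_def
    proof (rule integral_cong_AE)
      have [measurable]: "(\<lambda>s. h (t + s)) \<in> borel_measurable half_line"
        using measurable_translate[OF h] t by simp
      have [measurable]: "f \<in> borel_measurable half_line" using f by (rule L2_measurable)
      show "(\<lambda>s. h (t + s) * f s) \<in> borel_measurable half_line" by measurable
      show "(\<lambda>s. \<Sum>m\<in>I. of_real (p m) * e m t * (e m s * f s)) \<in> borel_measurable half_line"
        using int(1) by (intro borel_measurable_integrable Bochner_Integration.integrable_sum integrable_mult_right)
      \<comment> \<open>The formula for \<open>h\<close> holds off a null set, which is translated
        separately for each fixed \<open>t\<close>.\<close>
      have "AE s in half_line. h (t + s) = of_real (\<Sum>m\<in>I. p m * exp (- \<alpha> m * (t + s)))"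
        using AE_translate[OF sum] t by simp
      then show "AE s in half_line. h (t + s) * f s = (\<Sum>m\<in>I. of_real (p m) * e m t * (e m s * f s))"
      proof eventually_elim
        case (elim s)
        have "h (t + s) = (\<Sum>m\<in>I. of_real (p m) * e m (t + s))"
          unfolding elim by (simp add: e_def)
        then show ?case by (simp add: e_add sum_distrib_right mult.assoc)
      qed
    qed
    also have "\<dots> = (\<Sum>m\<in>I. LINT s|half_line. of_real (p m) * e m t * (e m s * f s))"
      using int(1) by (intro Bochner_Integration.integral_sum integrable_mult_right)
    also have "\<dots> = (\<Sum>m\<in>I. of_real (p m) * \<phi> m * e m t)"
      by (simp add: \<phi>_def) (simp add: mult_ac)
    finally show ?thesis .
  qed
  have "L2_inner (hankel_op h f) f
      = (LINT t|half_line. (\<Sum>m\<in>I. of_real (p m) * \<phi> m * (e m t * cnj (f t))))"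
    unfolding L2_inner_def
    by (intro Bochner_Integration.integral_cong refl) (simp add: H sum_distrib_right mult.assoc)
  also have "\<dots> = (\<Sum>m\<in>I. LINT t|half_line. of_real (p m) * \<phi> m * (e m t * cnj (f t)))"
    using int(2) by (intro Bochner_Integration.integral_sum integrable_mult_right)
  also have "\<dots> = (\<Sum>m\<in>I. of_real (p m) * (\<phi> m * cnj (\<phi> m)))"
    by (simp add: cnj mult.assoc)
  also have "\<dots> = of_real (\<Sum>m\<in>I. p m * (cmod (\<phi> m))\<^sup>2)"
    by (simp add: complex_norm_square del: of_real_power)
  finally show ?thesis by (simp add: \<phi>_def e_def)
qed

text \<open>Necessity is \<open>positive_kernel\<close>, re-indexed; sufficiency holds because the
  form is a positively weighted sum of squared moduli.\<close>

lemma hankel_positive_iff: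
  assumes "hankel_kernel h" "L2_finite_rank (hankel_op h)"
  shows "L2_positive (hankel_op h) \<longleftrightarrow>
    (\<exists>(M::nat) (p :: nat \<Rightarrow> real) (\<alpha> :: nat \<Rightarrow> real).
      (\<forall>m\<in>{1..M}. \<alpha> m > 0 \<and> p m > 0) \<and>
      (AE t in half_line. h t = of_real (\<Sum>m=1..M. p m * exp (- \<alpha> m * t))))"
proof
  assume pos: "L2_positive (hankel_op h)"
  interpret hankel h by standard (rule assms(1))
  obtain Z c where Z: "finite Z" "\<forall>l\<in>Z. l < 0 \<and> c l > 0"
    and h: "AE t in half_line. h t = of_real (\<Sum>l\<in>Z. c l * exp (l * t))"
    using positive_kernel[OF assms(2) pos] by auto
  show "\<exists>(M::nat) (p :: nat \<Rightarrow> real) (\<alpha> :: nat \<Rightarrow> real).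
      (\<forall>m\<in>{1..M}. \<alpha> m > 0 \<and> p m > 0) \<and>
      (AE t in half_line. h t = of_real (\<Sum>m=1..M. p m * exp (- \<alpha> m * t)))"
    by (rule finite_exp_sum_indexed[OF Z]) (use h in auto)
next
  assume "\<exists>(M::nat) (p :: nat \<Rightarrow> real) (\<alpha> :: nat \<Rightarrow> real).
      (\<forall>m\<in>{1..M}. \<alpha> m > 0 \<and> p m > 0) \<and>
      (AE t in half_line. h t = of_real (\<Sum>m=1..M. p m * exp (- \<alpha> m * t)))"
  then obtain M :: nat and p \<alpha> :: "nat \<Rightarrow> real"
    where *: "\<And>m. m \<in> {1..M} \<Longrightarrow> \<alpha> m > 0" "\<And>m. m \<in> {1..M} \<Longrightarrow> p m > 0"
      and h: "AE t in half_line. h t = of_real (\<Sum>m=1..M. p m * exp (- \<alpha> m * t))" by blast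
  have meas: "h \<in> borel_measurable half_line" using assms(1) by (simp add: hankel_kernel_def)
  show "L2_positive (hankel_op h)"
    unfolding L2_positive_def
  proof
    fix f assume f: "f \<in> L2"
    have "0 \<le> (\<Sum>m=1..M. p m * (cmod (LINT s|half_line. of_real (exp (- \<alpha> m * s)) * f s))\<^sup>2)"
      by (intro sum_nonneg mult_nonneg_nonneg less_imp_le[OF *(2)]) auto
    then show "L2_inner (hankel_op h f) f \<in> \<real>\<^sub>\<ge>\<^sub>0"
      using hankel_form_exp_sum[where I = "{1..M}", OF meas h *(1) f]
      by (simp only: nonneg_Reals_of_real_iff)
  qed
qed

section \<open>Negative operators by change of sign\<close>

lemma hankel_op_uminus: "hankel_op (\<lambda>t. - h t) f = (\<lambda>t. - hankel_op h f t)"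
  by (simp add: hankel_op_def fun_eq_iff)

lemma hankel_kernel_uminus:
  assumes "hankel_kernel h"
  shows "hankel_kernel (\<lambda>t. - h t)"
  using assms by (simp add: hankel_kernel_def L2_bounded_def hankel_op_uminus L2_norm_def L2_def)

lemma L2_finite_rank_uminus:
  assumes "L2_finite_rank (hankel_op h)"
  shows "L2_finite_rank (hankel_op (\<lambda>t. - h t))"
proof -
  obtain n :: nat and g where g: "\<forall>i<n. g i \<in> L2" "\<forall>f\<in>L2. \<exists>c :: nat \<Rightarrow> complex.
      AE t in half_line. hankel_op h f t = (\<Sum>i<n. c i * g i t)"
    using assms unfolding L2_finite_rank_def by blast
  have "\<exists>c :: nat \<Rightarrow> complex. AE t in half_line. hankel_op (\<lambda>t. - h t) f t = (\<Sum>i<n. c i * g i t)"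
    if f: "f \<in> L2" for f
  proof -
    obtain c :: "nat \<Rightarrow> complex" where "AE t in half_line. hankel_op h f t = (\<Sum>i<n. c i * g i t)"
      using g(2) f by blast
    then have "AE t in half_line. hankel_op (\<lambda>t. - h t) f t = (\<Sum>i<n. (- c i) * g i t)"
      by eventually_elim (simp add: hankel_op_uminus sum_negf)
    then show ?thesis by (intro exI[of _ "\<lambda>i. - c i"])
  qed
  then show ?thesis using g(1) unfolding L2_finite_rank_def by blast
qed

lemma L2_negative_iff_positive_uminus:
  "L2_negative (hankel_op h) \<longleftrightarrow> L2_positive (hankel_op (\<lambda>t. - h t))"
  by (simp add: L2_negative_def L2_positive_def L2_inner_def hankel_op_uminus
      complex_nonneg_Reals_iff complex_nonpos_Reals_iff)

theorem corollary1p2: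
  fixes h :: "real \<Rightarrow> complex"
  assumes "hankel_kernel h"
    and "L2_finite_rank (hankel_op h)"
  shows "(L2_positive (hankel_op h) \<longleftrightarrow>
      (\<exists>(M\<^sub>0::nat) (p :: nat \<Rightarrow> real) (\<alpha> :: nat \<Rightarrow> real).
        (\<forall>m\<in>{1..M\<^sub>0}. \<alpha> m > 0 \<and> p m > 0) \<and>
        (AE t in half_line. h t = of_real (\<Sum>m=1..M\<^sub>0. p m * exp (- \<alpha> m * t))))) \<and>
    (L2_negative (hankel_op h) \<longleftrightarrow>
      (\<exists>(M\<^sub>0::nat) (p :: nat \<Rightarrow> real) (\<alpha> :: nat \<Rightarrow> real).
        (\<forall>m\<in>{1..M\<^sub>0}. \<alpha> m > 0 \<and> p m < 0) \<and>
        (AE t in half_line. h t = of_real (\<Sum>m=1..M\<^sub>0. p m * exp (- \<alpha> m * t)))))"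
proof (intro conjI)
  let ?Q = "\<lambda>h (M::nat) (p :: nat \<Rightarrow> real) (\<alpha> :: nat \<Rightarrow> real).
    AE t in half_line. h t = complex_of_real (\<Sum>m=1..M. p m * exp (- \<alpha> m * t))"
  show "L2_positive (hankel_op h) \<longleftrightarrow>
      (\<exists>M p \<alpha>. (\<forall>m\<in>{1..M}. \<alpha> m > 0 \<and> p m > 0) \<and> ?Q h M p \<alpha>)"
    by (rule hankel_positive_iff[OF assms])
  have flip: "?Q (\<lambda>t. - h t) M p \<alpha> \<longleftrightarrow> ?Q h M (\<lambda>m. - p m) \<alpha>" for M p \<alpha>
  proof -
    have "- a = b \<longleftrightarrow> a = - b" for a b :: complex by auto
    then show ?thesis by (simp add: sum_negf)
  qed
  \<comment> \<open>The negative case is the positive case for the kernel \<open>- h\<close>;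
    negating the weights returns to \<open>h\<close> with the same exponents.\<close>
  have "L2_negative (hankel_op h) \<longleftrightarrow>
      (\<exists>M p \<alpha>. (\<forall>m\<in>{1..M}. \<alpha> m > 0 \<and> p m > 0) \<and> ?Q (\<lambda>t. - h t) M p \<alpha>)"
    unfolding L2_negative_iff_positive_uminus
    by (rule hankel_positive_iff[OF hankel_kernel_uminus[OF assms(1)] L2_finite_rank_uminus[OF assms(2)]])
  also have "\<dots> \<longleftrightarrow> (\<exists>M p \<alpha>. (\<forall>m\<in>{1..M}. \<alpha> m > 0 \<and> p m < 0) \<and> ?Q h M p \<alpha>)"
  proof (intro iffI; elim exE conjE)
    fix M :: nat and p \<alpha> :: "nat \<Rightarrow> real"
    assume "\<forall>m\<in>{1..M}. \<alpha> m > 0 \<and> p m > 0" "?Q (\<lambda>t. - h t) M p \<alpha>"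
    then show "\<exists>M p \<alpha>. (\<forall>m\<in>{1..M}. \<alpha> m > 0 \<and> p m < 0) \<and> ?Q h M p \<alpha>"
      unfolding flip by (intro exI[of _ M] exI[of _ "\<lambda>m. - p m"] exI[of _ \<alpha>] conjI) simp
  next
    fix M :: nat and p \<alpha> :: "nat \<Rightarrow> real"
    assume "\<forall>m\<in>{1..M}. \<alpha> m > 0 \<and> p m < 0" "?Q h M p \<alpha>"
    then show "\<exists>M p \<alpha>. (\<forall>m\<in>{1..M}. \<alpha> m > 0 \<and> p m > 0) \<and> ?Q (\<lambda>t. - h t) M p \<alpha>"
      unfolding flip
      by (intro exI[of _ M] exI[of _ "\<lambda>m. - p m"] exI[of _ \<alpha>] conjI) (simp_all only: minus_minus, simp)
  qed
  finally show "L2_negative (hankel_op h) \<longleftrightarrow>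
      (\<exists>M p \<alpha>. (\<forall>m\<in>{1..M}. \<alpha> m > 0 \<and> p m < 0) \<and> ?Q h M p \<alpha>)" .
qed

end
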